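(* For every integer $d\ge1$, let $\Gamma_d\in[0,\infty]$ be the value of the response-history escape game in dimension $d$ and let $\kappa_d=\exp\left(\int_0^{1/2}\frac{t^{d-1}}{1-t^2}\,dt\right)$. Then for every $d\ge1$, $$\kappa_d\le\Gamma_d\le\Gamma_1=\frac32+\sqrt2.$$ In particular, $$\frac{2}{\sqrt3}\le\Gamma_2\le\frac32+\sqrt2.$$
   Context: $\|\cdot\|$ is the Euclidean norm on $\mathbb{R}^d$. Escape game in dimension $d$. A finite response history of length $n\ge0$ is $H=(x_0,\dots,x_n;r_0,\dots,r_{n-1})$ with all $x_i,r_i\in\mathbb{R}^d$ (no responses if $n=0$). Its state radius is $\operatorname{rad}(H)=\max_{0\le i\le n}\|x_i-x_0\|$. For $u,r\in\mathbb{R}^d$ the successor history is $H^+(u,r)=(x_0,\dots,x_n,u+r;r_0,\dots,r_{n-1},r)$. For $\ell\ge0$, $\operatorname{Env}_\ell(H)=0$ if $n=0$, and $\operatorname{Env}_\ell(H)=\max_{0\le i,j\le n-1}(\|r_i-r_j\|-\ell\|x_i-x_j\|)_+$ if $n\ge1$, where $q_+=\max\{q,0\}$. A play from an initial history $H^0$ is a sequence $\pi=(H^k,u_k,r_k,H^{k+1})_{k\ge0}$ with $u_k,r_k\in\mathbb{R}^d$ and $H^{k+1}=(H^k)^+(u_k,r_k)$. At stage $k$ the controller sees $H^k$ and chooses $u_k$; then the adversary sees $(H^k,u_k)$ and chooses $r_k$. A controller strategy is an arbitrary map $\mu$ from finite response histories to $\mathbb{R}^d$ ($u_k=\mu(H^k)$);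 an adversary strategy is an arbitrary map $\sigma$ from pairs $(H,u)$ to $\mathbb{R}^d$ ($r_k=\sigma(H^k,u_k)$). Let $\operatorname{Env}^\infty_\ell(\pi)=\sup_k\operatorname{Env}_\ell(H^k)$, and let $\operatorname{Esc}_{\ell,H^0}$ be the set of plays $\pi$ from $H^0$ with $\operatorname{Env}^\infty_\ell(\pi)<\infty$ and $\sup_k\operatorname{rad}(H^k)=\infty$. The adversary wins from $H^0$ for $\operatorname{Esc}_{\ell,H^0}$ if there is an adversary strategy $\sigma$ such that for every controller strategy $\mu$ the resulting play lies in $\operatorname{Esc}_{\ell,H^0}$. Let $\mathcal U_\ell$ be the set of finite response histories $H$ (in dimension $d$) from which the adversary wins for $\operatorname{Esc}_{\ell,H}$. The game value is $$\Gamma_d=\sup\bigl(\{0\}\cup\{\ell\ge0\mid\mathcal U_\ell=\varnothing\}\bigr)\in[0,\infty].$$ *)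

theory Defs
  imports "HOL-Analysis.Analysis"
begin

text \<open>
  The response history \<open>(x\<^sub>0, \<dots>, x\<^sub>n; r\<^sub>0, \<dots>, r\<^sub>n\<^sub>-\<^sub>1)\<close> is the pair of lists
  \<open>([x\<^sub>0, \<dots>, x\<^sub>n], [r\<^sub>0, \<dots>, r\<^sub>n\<^sub>-\<^sub>1])\<close>. The pairs of this shape are singled out by
  \<open>response_history\<close>. Strategies are total on all pairs of lists; their values
  at pairs of another shape are never used in a play from a response history.
\<close>

type_synonym 'a history = "'a list \<times> 'a list"

definition response_history :: "'a history \<Rightarrow> bool" where
  "response_history H \<longleftrightarrow> length (fst H) = Suc (length (snd H))"

definition rad :: "'a::euclidean_space history \<Rightarrow> real" where
  "rad H = (case H of (x, r) \<Rightarrow> Max {norm (x ! i - x ! 0) | i. i \<le> length r})"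

definition succ_history :: "'a::euclidean_space history \<Rightarrow> 'a \<Rightarrow> 'a \<Rightarrow> 'a history" where
  "succ_history H u r = (fst H @ [u + r], snd H @ [r])"

definition Env :: "real \<Rightarrow> 'a::euclidean_space history \<Rightarrow> real" where
  "Env l H = (case H of (x, r) \<Rightarrow>
     if r = [] then 0
     else Max {max (norm (r ! i - r ! j) - l * norm (x ! i - x ! j)) 0 | i j.
                 i < length r \<and> j < length r})"

text \<open>The entry at stage \<open>k\<close> of a play is \<open>(H\<^sup>k, u\<^sub>k, r\<^sub>k, H\<^sup>k\<^sup>+\<^sup>1)\<close>.\<close>

type_synonym 'a play = "nat \<Rightarrow> 'a history \<times> 'a \<times> 'a \<times> 'a history"

definition plays :: "'a::euclidean_space history \<Rightarrow> 'a play set" where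
  "plays H0 = {\<lambda>k. (H k, u k, r k, H (Suc k)) | H u r.
     H 0 = H0 \<and> (\<forall>k. H (Suc k) = succ_history (H k) (u k) (r k))}"

type_synonym 'a controller = "'a history \<Rightarrow> 'a"
type_synonym 'a adversary = "'a history \<times> 'a \<Rightarrow> 'a"

primrec history_at ::
  "'a::euclidean_space controller \<Rightarrow> 'a adversary \<Rightarrow> 'a history \<Rightarrow> nat \<Rightarrow> 'a history" where
  "history_at \<mu> \<sigma> H0 0 = H0"
| "history_at \<mu> \<sigma> H0 (Suc k) =
     (let H = history_at \<mu> \<sigma> H0 k; u = \<mu> H in succ_history H u (\<sigma> (H, u)))"

definition resulting_play ::
  "'a::euclidean_space controller \<Rightarrow> 'a adversary \<Rightarrow> 'a history \<Rightarrow> 'a play" where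
  "resulting_play \<mu> \<sigma> H0 = (\<lambda>k.
     let H = history_at \<mu> \<sigma> H0 k; u = \<mu> H
     in (H, u, \<sigma> (H, u), history_at \<mu> \<sigma> H0 (Suc k)))"

text \<open>
  Both \<open>Env l H\<close> and \<open>rad H\<close> are nonnegative for a response history \<open>H\<close>, so
  \<open>ennreal\<close> does not truncate them.
\<close>

definition Env_inf :: "real \<Rightarrow> 'a::euclidean_space play \<Rightarrow> ennreal" where
  "Env_inf l \<pi> = (SUP k. ennreal (Env l (fst (\<pi> k))))"

definition Esc :: "real \<Rightarrow> 'a::euclidean_space history \<Rightarrow> 'a play set" where
  "Esc l H0 = {\<pi> \<in> plays H0.
     Env_inf l \<pi> < \<infinity> \<and> (SUP k. ennreal (rad (fst (\<pi> k)))) = \<infinity>}"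

definition adversary_wins :: "real \<Rightarrow> 'a::euclidean_space history \<Rightarrow> bool" where
  "adversary_wins l H \<longleftrightarrow> (\<exists>\<sigma>. \<forall>\<mu>. resulting_play \<mu> \<sigma> H \<in> Esc l H)"

definition winning_histories :: "real \<Rightarrow> 'a::euclidean_space history set" where
  "winning_histories l = {H. response_history H \<and> adversary_wins l H}"

text \<open>
  The dimension enters through the type: \<open>\<Gamma>\<^sub>d\<close> is \<open>game_value TYPE(real ^ 'n)\<close> with
  \<open>CARD('n) = d\<close>.
\<close>

definition game_value :: "'a::euclidean_space itself \<Rightarrow> ennreal" where
  "game_value _ =
     Sup ({0} \<union> {ennreal l | l. l \<ge> 0 \<and> (winning_histories l :: 'a history set) = {}})"

definition kappa :: "nat \<Rightarrow> real" where
  "kappa d = exp (integral {0..1/2} (\<lambda>t. t ^ (d - 1) / (1 - t\<^sup>2)))"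

end

theory Submission
  imports Defs
begin

text \<open>
  Lower bounds: the controller copies the response to the nearest earlier state, at distance \<open>\<delta>\<close>,
  so that the next state lies within \<open>l \<delta> + c\<close> of a target of its choice. In dimension one the
  target is the midpoint of the range \<open>R\<close>. A new largest gap \<open>G\<close> arises only by an extension of the
  range by at most \<open>l G + c - R / 2\<close>, which lowers the ratio \<open>G / R\<close> by a fixed amount as long as
  \<open>l\<^sup>2 - 3 l + 1 / 4 < 0\<close>, that is, up to \<open>l = 3 / 2 + sqrt 2\<close>; so there are finitely many new largest
  gaps and the range stays bounded. In dimension \<open>d\<close> the target is the initial state. At the times
  when the radius \<open>M\<close> grows, balls of radius about \<open>M / (2 l)\<close> around the states are disjoint. In the
  dilation-invariant measure \<open>|y|\<^sup>-\<^sup>d dy\<close> an annulus has mass proportional to the logarithm of the ratio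
  of its radii, and the mean value property of the Poisson kernel gives the mass of a ball in terms
  of the integral in the definition of \<open>kappa\<close>; comparing the two bounds \<open>ln M\<close>.

  Upper bound: the adversary plays on a line and answers each state outside the previous range at
  distance \<open>l\<close> times the last extension from the midpoint. The ranges then satisfy
  \<open>R\<^sub>n\<^sub>+\<^sub>1 \<ge> (l + 1 / 2) R\<^sub>n - l R\<^sub>n\<^sub>-\<^sub>1\<close> and grow geometrically once \<open>l + 1 / 2 \<ge> 2 sqrt l\<close>.
\<close>

section \<open>Plays as sequences\<close>

text \<open>Moves only append to a history, so all histories of a play are prefixes of one infinite
  sequence of states and one of responses. Stage \<open>k\<close> starts with
  \<open>length (snd H0) + k\<close> responses and one more state, which explains the index
  shifts.\<close>

lemma history_at_sequences:
  fixes H0 :: "'a::euclidean_space history"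
  assumes "response_history H0"
  obtains x r :: "nat \<Rightarrow> 'a" where
    "\<And>k. history_at \<mu> \<sigma> H0 k =
       (map x [0..<Suc (length (snd H0) + k)], map r [0..<length (snd H0) + k])"
    "\<And>k. r (length (snd H0) + k) = \<sigma> (history_at \<mu> \<sigma> H0 k, \<mu> (history_at \<mu> \<sigma> H0 k))"
    "\<And>k. x (Suc (length (snd H0) + k)) =
       \<mu> (history_at \<mu> \<sigma> H0 k) + r (length (snd H0) + k)"
proof -
  define N where "N = length (snd H0)"
  let ?H = "history_at \<mu> \<sigma> H0"
  define r where "r i = (if i < N then snd H0 ! i else \<sigma> (?H (i - N), \<mu> (?H (i - N))))" for i
  define x where "x i = (if i \<le> N then fst H0 ! i else \<mu> (?H (i - Suc N)) + r (i - 1))" for i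
  have H: "?H k = (map x [0..<Suc (N + k)], map r [0..<N + k])" for k
  proof (induction k)
    case 0
    have "fst H0 = map x [0..<Suc N]"
      using assms by (intro nth_equalityI) (auto simp: response_history_def x_def N_def simp del: upt_Suc)
    moreover have "snd H0 = map r [0..<N]"
      by (intro nth_equalityI) (auto simp: r_def N_def)
    ultimately show ?case by (simp add: prod_eq_iff)
  next
    case (Suc k)
    have "?H (Suc k) = succ_history (?H k) (\<mu> (?H k)) (\<sigma> (?H k, \<mu> (?H k)))"
      by (simp add: Let_def)
    also have "\<dots> = succ_history (?H k) (\<mu> (?H k)) (r (N + k))"
      by (simp add: r_def)
    also have "\<dots> = (fst (?H k) @ [x (Suc (N + k))], snd (?H k) @ [r (N + k)])"
      by (simp add: succ_history_def x_def)
    also have "\<dots> = (map x [0..<Suc (N + Suc k)], map r [0..<N + Suc k])"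
      unfolding Suc.IH by simp
    finally show ?case .
  qed
  show thesis
    by (rule that[of x r]) (use H in \<open>simp_all add: N_def[symmetric] x_def r_def\<close>)
qed

lemma resulting_play_in_plays: "resulting_play \<mu> \<sigma> H0 \<in> plays H0"
  unfolding plays_def
  by (rule CollectI, intro exI[of _ "history_at \<mu> \<sigma> H0"] exI[of _ "\<lambda>k. \<mu> (history_at \<mu> \<sigma> H0 k)"]
        exI[of _ "\<lambda>k. \<sigma> (history_at \<mu> \<sigma> H0 k, \<mu> (history_at \<mu> \<sigma> H0 k))"])
    (auto simp: resulting_play_def Let_def)

text \<open>Negative values of \<open>f\<close> are sent to 0 by \<open>ennreal\<close>; this is
  harmless because a finite supremum is \<open>ennreal c\<close> for some \<open>c\<close> with
  \<open>0 \<le> c\<close>.\<close>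

lemma SUP_ennreal_less_top_iff:
  "(SUP k. ennreal (f k)) < \<infinity> \<longleftrightarrow> (\<exists>c. \<forall>k. f k \<le> c)"
proof
  assume "(SUP k. ennreal (f k)) < \<infinity>"
  then obtain c where "0 \<le> c" and c: "(SUP k. ennreal (f k)) = ennreal c"
    by (cases "SUP k. ennreal (f k)") auto
  have "f k \<le> c" for k
  proof -
    have "ennreal (f k) \<le> ennreal c" unfolding c[symmetric] by (rule SUP_upper) simp
    then show ?thesis using \<open>0 \<le> c\<close> by simp
  qed
  then show "\<exists>c. \<forall>k. f k \<le> c" by blast
next
  assume "\<exists>c. \<forall>k. f k \<le> c"
  then obtain c where "\<And>k. f k \<le> c" by blast
  then have "(SUP k. ennreal (f k)) \<le> ennreal c"
    by (intro SUP_least ennreal_leI)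
  then show "(SUP k. ennreal (f k)) < \<infinity>"
    by (simp add: order_le_less_trans)
qed

lemma rad_map_le_iff:
  "rad (map x [0..<Suc n], map r [0..<n]) \<le> B \<longleftrightarrow> (\<forall>i\<le>n. norm (x i - x 0) \<le> B)"
proof -
  have nth: "map x [0..<Suc n] ! i = x i" if "i \<le> n" for i
    using that by (simp add: less_Suc_eq_le del: upt_Suc)
  have "{norm (map x [0..<Suc n] ! i - map x [0..<Suc n] ! 0) |i. i \<le> length (map r [0..<n])}
      = (\<lambda>i. norm (x i - x 0)) ` {..n}"
    unfolding setcompr_eq_image by (intro image_cong) (auto simp: nth simp del: upt_Suc)
  then show ?thesis
    by (auto simp add: rad_def simp del: upt_Suc)
qed

text \<open>The sign of \<open>c\<close> absorbs the positive part and the value 0 given to a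
  history without responses. The last state \<open>x n\<close> has no response yet, so only indices
  below \<open>n\<close> occur.\<close>

lemma Env_map_le_iff:
  assumes "c \<ge> 0"
  shows "Env l (map x [0..<Suc n], map r [0..<n]) \<le> c
    \<longleftrightarrow> (\<forall>i<n. \<forall>j<n. norm (r i - r j) \<le> l * norm (x i - x j) + c)"
proof (cases "n = 0")
  case True
  then show ?thesis using assms by (simp add: Env_def)
next
  case False
  let ?f = "\<lambda>(i, j). max (norm (r i - r j) - l * norm (x i - x j)) 0"
  have "{max (norm (map r [0..<n] ! i - map r [0..<n] ! j)
           - l * norm (map x [0..<Suc n] ! i - map x [0..<Suc n] ! j)) 0 | i j.
           i < length (map r [0..<n]) \<and> j < length (map r [0..<n])}
      = ?f ` ({..<n} \<times> {..<n})"
    by (force simp: image_def simp del: upt_Suc)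
  then have "Env l (map x [0..<Suc n], map r [0..<n]) = Max (?f ` ({..<n} \<times> {..<n}))"
    using False by (simp add: Env_def del: upt_Suc)
  also have "\<dots> \<le> c \<longleftrightarrow> (\<forall>p\<in>{..<n} \<times> {..<n}. ?f p \<le> c)"
    using False by (subst Max_le_iff) auto
  also have "\<dots> \<longleftrightarrow> (\<forall>i<n. \<forall>j<n. norm (r i - r j) \<le> l * norm (x i - x j) + c)"
    using assms by (force simp: algebra_simps)
  finally show ?thesis .
qed

text \<open>Every pair of indices is present from some stage on, so the suprema over stages become
  quantifiers over indices. What remains is a Lipschitz condition on the responses up to an additive
  error, and unboundedness of the states.\<close>

lemma resulting_play_in_Esc_iff:
  assumes H: "\<And>k. history_at \<mu> \<sigma> H0 k = (map x [0..<Suc (N + k)], map r [0..<N + k])"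
  shows "resulting_play \<mu> \<sigma> H0 \<in> Esc l H0 \<longleftrightarrow>
    (\<exists>c. \<forall>i j. norm (r i - r j) \<le> l * norm (x i - x j) + c) \<and> (\<forall>B. \<exists>n. B < norm (x n - x 0))"
proof -
  have fst: "fst (resulting_play \<mu> \<sigma> H0 k) = (map x [0..<Suc (N + k)], map r [0..<N + k])" for k
    by (simp add: resulting_play_def Let_def H del: upt_Suc)
  have "(\<exists>c. \<forall>k. Env l (map x [0..<Suc (N + k)], map r [0..<N + k]) \<le> c)
      \<longleftrightarrow> (\<exists>c\<ge>0. \<forall>k. Env l (map x [0..<Suc (N + k)], map r [0..<N + k]) \<le> c)"
    by (meson linorder_le_cases order_trans)
  also have "\<dots> \<longleftrightarrow> (\<exists>c\<ge>0. \<forall>k. \<forall>i<N+k. \<forall>j<N+k. norm (r i - r j) \<le> l * norm (x i - x j) + c)"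
    using Env_map_le_iff by (metis (no_types, lifting))
  also have "\<dots> \<longleftrightarrow> (\<exists>c\<ge>0. \<forall>i j. norm (r i - r j) \<le> l * norm (x i - x j) + c)"
  proof -
    have "\<exists>k. i < N + k \<and> j < N + k" for i j :: nat
      by (intro exI[of _ "Suc (i + j)"]) simp
    then show ?thesis by meson
  qed
  also have "\<dots> \<longleftrightarrow> (\<exists>c. \<forall>i j. norm (r i - r j) \<le> l * norm (x i - x j) + c)"
  proof -
    have "0 \<le> c" if "\<And>i j. norm (r i - r j) \<le> l * norm (x i - x j) + c" for c
      using that[of 0 0] by simp
    then show ?thesis by blast
  qed
  finally have env: "(\<exists>c. \<forall>k. Env l (map x [0..<Suc (N + k)], map r [0..<N + k]) \<le> c)
    \<longleftrightarrow> (\<exists>c. \<forall>i j. norm (r i - r j) \<le> l * norm (x i - x j) + c)" .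
  have rad: "(\<exists>B. \<forall>k. rad (map x [0..<Suc (N + k)], map r [0..<N + k]) \<le> B)
      \<longleftrightarrow> (\<exists>B. \<forall>n. norm (x n - x 0) \<le> B)"
    unfolding rad_map_le_iff by (meson le_add2)
  have "(SUP k. ennreal (rad (fst (resulting_play \<mu> \<sigma> H0 k)))) = \<infinity>
    \<longleftrightarrow> \<not> (SUP k. ennreal (rad (fst (resulting_play \<mu> \<sigma> H0 k)))) < \<infinity>"
    by (auto simp: less_top[symmetric] simp del: SUP_eq_top_iff)
  then show ?thesis
    unfolding Esc_def Env_inf_def using resulting_play_in_plays[of \<mu> \<sigma> H0] env rad
    by (simp only: mem_Collect_eq SUP_ennreal_less_top_iff fst) (auto simp: not_le[symmetric])
qed

text \<open>Against the winning adversary the controller plays \<open>p - r i\<close>, where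
  \<open>i\<close> is the index of the nearest earlier state; then
  \<open>x (Suc n) - p = r n - r i\<close>, which the bounded envelope controls. Nearness of
  \<open>i\<close> gives the bound with every \<open>j < n\<close>, and only the geometry of the
  sequence \<open>x\<close> is left to study.\<close>

lemma nearest_neighbour_controller:
  fixes p :: "'a::euclidean_space list \<Rightarrow> 'a"
  assumes "l \<ge> 0" and "(winning_histories l :: 'a history set) \<noteq> {}"
  obtains x :: "nat \<Rightarrow> 'a" and c :: real and N :: nat where "c \<ge> 0" "N \<ge> 1"
    "\<And>n j. n \<ge> N \<Longrightarrow> j < n \<Longrightarrow>
       norm (x (Suc n) - p (map x [0..<Suc n])) \<le> l * norm (x n - x j) + c"
    "\<And>B. \<exists>n. B < norm (x n - x 0)"
proof -
  obtain H0 :: "'a history" and \<sigma> where H0: "response_history H0"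
    and win: "\<And>\<mu>. resulting_play \<mu> \<sigma> H0 \<in> Esc l H0"
    using assms(2) by (auto simp: winning_histories_def adversary_wins_def)
  \<comment> \<open>The index set stops before the last entry because the current state has no
    response to copy.\<close>
  define near :: "'a list \<Rightarrow> nat" where
    "near xs = arg_min_on (\<lambda>i. norm (last xs - xs ! i)) {..<length xs - 1}" for xs
  define \<mu> where "\<mu> = (\<lambda>(xs, rs). p xs - rs ! near xs)"
  define K where "K = length (snd H0)"
  obtain x r where H: "\<And>k. history_at \<mu> \<sigma> H0 k = (map x [0..<Suc (K + k)], map r [0..<K + k])"
    and x: "\<And>k. x (Suc (K + k)) = \<mu> (history_at \<mu> \<sigma> H0 k) + r (K + k)"
    using history_at_sequences[OF H0] unfolding K_def by metis
  obtain c where c: "\<And>i j. norm (r i - r j) \<le> l * norm (x i - x j) + c"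
    and unb: "\<And>B. \<exists>n. B < norm (x n - x 0)"
    using win[of \<mu>] unfolding resulting_play_in_Esc_iff[of \<mu> \<sigma> H0 x K r, OF H] by blast
  \<comment> \<open>From \<open>Suc K\<close> on, \<open>x (Suc n)\<close> results from the move at
    stage \<open>n - K\<close>, and an earlier state with a known response exists.\<close>
  have "norm (x (Suc n) - p (map x [0..<Suc n])) \<le> l * norm (x n - x j) + c"
    if "n \<ge> Suc K" "j < n" for n j
  proof -
    define i where "i = near (map x [0..<Suc n])"
    have i: "i = arg_min_on (\<lambda>i. norm (x n - map x [0..<Suc n] ! i)) {..<n}"
      unfolding i_def near_def by simp
    have "i \<in> {..<n}" unfolding i by (rule arg_min_if_finite(1)) (use that in auto)
    have "norm (x n - map x [0..<Suc n] ! i) \<le> norm (x n - map x [0..<Suc n] ! j)"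
      unfolding i by (rule arg_min_least) (use that in auto)
    then have le: "norm (x n - x i) \<le> norm (x n - x j)"
      using \<open>i \<in> {..<n}\<close> that by (simp add: nth_append less_Suc_eq del: upt_Suc)
    have "x (Suc n) = p (map x [0..<Suc n]) - map r [0..<n] ! i + r n"
      using x[of "n - K"] H[of "n - K"] that by (simp add: \<mu>_def i_def del: upt_Suc)
    then have "x (Suc n) - p (map x [0..<Suc n]) = r n - r i"
      using \<open>i \<in> {..<n}\<close> by (simp del: upt_Suc)
    moreover have "l * norm (x n - x i) \<le> l * norm (x n - x j)"
      using le assms(1) by (rule mult_left_mono)
    ultimately show ?thesis using c[of n i] by simp
  qed
  moreover have "c \<ge> 0" using c[of 0 0] by simp
  ultimately show thesis using that[of c "Suc K" x] unb by simp
qed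

section \<open>Midpoint control in dimension one\<close>

definition running_max :: "(nat \<Rightarrow> real) \<Rightarrow> nat \<Rightarrow> real" where
  "running_max y n = Max (y ` {..n})"

definition running_min :: "(nat \<Rightarrow> real) \<Rightarrow> nat \<Rightarrow> real" where
  "running_min y n = Min (y ` {..n})"

definition running_range :: "(nat \<Rightarrow> real) \<Rightarrow> nat \<Rightarrow> real" where
  "running_range y n = running_max y n - running_min y n"

definition running_mid :: "(nat \<Rightarrow> real) \<Rightarrow> nat \<Rightarrow> real" where
  "running_mid y n = (running_max y n + running_min y n) / 2"

lemma running_max_Suc: "running_max y (Suc n) = max (y (Suc n)) (running_max y n)"
  by (simp add: running_max_def atMost_Suc)

lemma running_min_Suc: "running_min y (Suc n) = min (y (Suc n)) (running_min y n)"
  by (simp add: running_min_def atMost_Suc)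

lemma running_max_ge: "i \<le> n \<Longrightarrow> y i \<le> running_max y n"
  by (simp add: running_max_def)

lemma running_min_le: "i \<le> n \<Longrightarrow> running_min y n \<le> y i"
  by (simp add: running_min_def)

lemma running_max_attained: obtains i where "i \<le> n" "y i = running_max y n"
proof -
  have "running_max y n \<in> y ` {..n}" unfolding running_max_def by (rule Max_in) auto
  then show thesis using that by auto
qed

lemma running_min_attained: obtains i where "i \<le> n" "y i = running_min y n"
proof -
  have "running_min y n \<in> y ` {..n}" unfolding running_min_def by (rule Min_in) auto
  then show thesis using that by auto
qed

lemma running_range_Suc_ge: "running_range y n \<le> running_range y (Suc n)"
  by (simp add: running_range_def running_max_Suc running_min_Suc)

lemma running_range_nonneg: "0 \<le> running_range y n"
  using running_max_ge[of 0 n y] running_min_le[of 0 n y] by (simp add: running_range_def)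

lemma diff_le_running_range: "i \<le> n \<Longrightarrow> \<bar>y i - y 0\<bar> \<le> running_range y n"
  using running_max_ge[of i n y] running_min_le[of i n y]
    running_max_ge[of 0 n y] running_min_le[of 0 n y]
  by (auto simp: running_range_def)

text \<open>A point at distance \<open>q\<close> from the midpoint of an interval of length
  \<open>R\<close> overshoots its nearer end by \<open>q - R / 2\<close> and extends the interval on
  that side only.\<close>

lemma running_range_Suc_le:
  "running_range y (Suc n) \<le> running_range y n
     + max 0 (\<bar>y (Suc n) - running_mid y n\<bar> - running_range y n / 2)"
  using running_range_nonneg[of y n]
  by (auto simp: running_range_def running_mid_def running_max_Suc running_min_Suc
      max_def min_def abs_if field_simps)

lemma running_range_Suc_outside:
  assumes "\<bar>y (Suc n) - running_mid y n\<bar> \<ge> running_range y n / 2"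
  shows "running_range y (Suc n) = \<bar>y (Suc n) - running_mid y n\<bar> + running_range y n / 2"
  using assms running_range_nonneg[of y n]
  by (auto simp: running_range_def running_mid_def running_max_Suc running_min_Suc
      max_def min_def abs_if field_simps split: if_splits)

text \<open>Once \<open>R\<close> is large, the ratio \<open>G / R\<close> never increases, and it
  drops by a fixed amount whenever \<open>G\<close> grows. Being nonnegative, it allows only
  finitely many growths; after the last one \<open>R\<close> stops growing as soon as it exceeds
  \<open>2 * (l * G + c)\<close>. The hypothesis on \<open>l\<close> says that the discriminant
  \<open>(l - 1 / 2)\<^sup>2 - 2 * l\<close> of the quadratic measuring the drop is
  negative.\<close>

lemma range_gap_recursion_bounded:
  fixes R G :: "nat \<Rightarrow> real"
  assumes l: "l > 0" "l\<^sup>2 - 3 * l + 1 / 4 < 0"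
    and R: "\<And>n. R n \<le> R (Suc n)"
    and G0: "\<And>n. 0 \<le> G n"
    and G: "\<And>n. G (Suc n) \<le> max (G n) (R (Suc n) - R n)"
    and step: "\<And>n. R (Suc n) \<le> R n + max 0 (l * G n + c - R n / 2)"
  shows "\<exists>B. \<forall>n. R n \<le> B"
proof (rule ccontr)
  assume "\<nexists>B. \<forall>n. R n \<le> B"
  then have unb: "\<exists>n. B < R n" for B by (meson not_le)
  have mono: "m \<le> n \<Longrightarrow> R m \<le> R n" for m n by (rule lift_Suc_mono_le[of R]) (use R in auto)
  \<comment> \<open>The minimum over \<open>\<gamma>\<close> of the quadratic in
    \<open>quad\<close>, attained at \<open>(l - 1 / 2) / (2 * l)\<close>.\<close>
  define h where "h = 1 / 2 - (l - 1 / 2)\<^sup>2 / (4 * l)"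
  have h: "h > 0" using l by (simp add: h_def field_simps power2_eq_square)
  have quad: "h \<le> l * \<gamma>\<^sup>2 - (l - 1 / 2) * \<gamma> + 1 / 2" for \<gamma>
  proof -
    have "l * \<gamma>\<^sup>2 - (l - 1 / 2) * \<gamma> + 1 / 2 = h + l * (\<gamma> - (l - 1 / 2) / (2 * l))\<^sup>2"
      using l by (simp add: h_def field_simps power2_eq_square)
    then show ?thesis using l by simp
  qed
  \<comment> \<open>Beyond \<open>N\<close> the relative error \<open>c / R n\<close> is at most
    \<open>h / 2\<close> in absolute value.\<close>
  obtain N where N: "max 1 (2 * \<bar>c\<bar> / h) < R N" using unb by blast
  have big: "R n \<ge> 1" "\<bar>c\<bar> \<le> h / 2 * R n" if "n \<ge> N" for n
  proof -
    have "2 * \<bar>c\<bar> < h * R N" using N h by (auto simp: field_simps)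
    also have "h * R N \<le> h * R n" using mono[OF that] h by simp
    finally show "R n \<ge> 1" "\<bar>c\<bar> \<le> h / 2 * R n" using N mono[OF that] by auto
  qed
  define g where "g n = G n / R n" for n
  \<comment> \<open>An upper bound for \<open>R (Suc n) / R n\<close> at a step where
    \<open>G\<close> grows, as long as \<open>g n \<le> g N\<close>.\<close>
  define K where "K = l * g N + 1 / 2 + h / 2"
  have gK: "0 \<le> g n" if "n \<ge> N" for n using big[OF that] G0[of n] by (simp add: g_def)
  have K: "K > 0" unfolding K_def using gK[of N] l h by (simp add: add_nonneg_pos)
  have dec: "g (Suc n) \<le> g n \<and> (G n < G (Suc n) \<longrightarrow> g (Suc n) \<le> g n - h / (2 * K))"
    if n: "n \<ge> N" "g n \<le> g N" for n
  proof (cases "G n < G (Suc n)")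
    case False
    then have "g (Suc n) \<le> G n / R (Suc n)" using big[of "Suc n"] n
      by (simp add: g_def divide_right_mono)
    also have "\<dots> \<le> g n" unfolding g_def using R[of n] big[OF n(1)] G0[of n]
      by (intro divide_left_mono) auto
    finally show ?thesis using False by simp
  next
    case True
    define D where "D = (R (Suc n) - R n) / R n"
    define e where "e = c / R n"
    have Rn: "R n > 0" "R (Suc n) > 0" using big[OF n(1)] R[of n] by auto
    have Gd: "G (Suc n) \<le> R (Suc n) - R n" "R (Suc n) - R n > 0" using True G[of n] G0[of n] by auto
    have RD: "R (Suc n) = R n * (1 + D)" "D > 0" using Rn Gd by (auto simp: D_def field_simps)
    have "R (Suc n) - R n \<le> l * G n + c - R n / 2" using step[of n] Gd by auto
    then have "D \<le> (l * G n + c - R n / 2) / R n"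
      unfolding D_def using Rn by (intro divide_right_mono) auto
    also have "\<dots> = l * g n - 1 / 2 + e"
      using Rn by (simp add: g_def e_def field_simps)
    finally have D: "D \<le> l * g n - 1 / 2 + e" .
    have e: "\<bar>e\<bar> \<le> h / 2" using big[OF n(1)] by (simp add: e_def field_simps)
    have lgK: "l * g n \<le> l * g N" using n l by simp
    then have DK: "1 + D \<le> K" using D e by (simp add: K_def)
    have "g (Suc n) \<le> (R (Suc n) - R n) / R (Suc n)" unfolding g_def
      using Gd Rn by (intro divide_right_mono) auto
    also have "\<dots> = 1 - 1 / (1 + D)" using Rn RD by (simp add: field_simps)
    finally have 1: "g (Suc n) \<le> 1 - 1 / (1 + D)" .
    \<comment> \<open>\<open>1 - 1 / (1 + D)\<close>, that is \<open>D / (1 + D)\<close>, is the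
      ratio when the whole extension is the new gap. Clearing \<open>1 + D\<close> leaves a product
      that is at most one minus the quadratic of \<open>quad\<close>, up to the error
      \<open>e\<close>; for \<open>g n > 1\<close> the product is not positive.\<close>
    have "1 - 1 / (1 + D) \<le> g n - h / 2 / (1 + D)"
    proof -
      have "(1 - g n) * (1 + D) \<le> 1 - h / 2"
      proof (cases "g n \<le> 1")
        case True
        have "(1 - g n) * (1 + D) \<le> (1 - g n) * (l * g n + 1 / 2 + e)"
          using D True by (intro mult_left_mono) auto
        also have "\<dots> = 1 - (l * (g n)\<^sup>2 - (l - 1 / 2) * g n + 1 / 2) + (1 - g n) * e"
          by (simp add: algebra_simps power2_eq_square add_divide_distrib diff_divide_distrib)
        also have "(1 - g n) * e \<le> 1 * (h / 2)"
          using e True gK[OF n(1)] mult_mono[of "1 - g n" 1 "\<bar>e\<bar>" "h / 2"]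
            mult_left_mono[of e "\<bar>e\<bar>" "1 - g n"] by linarith
        finally show ?thesis using quad[of "g n"] by simp
      next
        case False
        then have "(1 - g n) * (1 + D) \<le> 0" using RD by (intro mult_nonpos_nonneg) auto
        moreover have "h / 2 \<le> 1" using quad[of 0] h by simp
        ultimately show ?thesis by simp
      qed
      then have "1 - g n \<le> (1 - h / 2) / (1 + D)" using RD by (simp add: pos_le_divide_eq)
      then show ?thesis by (simp add: diff_divide_distrib)
    qed
    also have "\<dots> \<le> g n - h / 2 / K"
      using DK RD h K by (intro diff_left_mono divide_left_mono mult_pos_pos) auto
    finally have "g (Suc n) \<le> g n - h / (2 * K)" using 1 by simp
    moreover have "h / (2 * K) > 0" using h K by simp
    ultimately show ?thesis by simp
  qed
  have gN: "g (N + k) \<le> g N" for k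
  proof (induction k)
    case (Suc k)
    then show ?case using dec[of "N + k"] by simp
  qed simp
  \<comment> \<open>A convergent sequence has steps tending to 0, so from some \<open>k0\<close> on
    no drop of size \<open>h / (2 * K)\<close> is left and \<open>G\<close> no longer grows.\<close>
  have "decseq (\<lambda>k. g (N + k))"
    by (rule decseq_SucI) (use dec gN in auto)
  then obtain L where L: "(\<lambda>k. g (N + k)) \<longlonglongrightarrow> L"
    using decseq_convergent[of "\<lambda>k. g (N + k)" 0] gK by (metis le_add1)
  have "(\<lambda>k. g (N + k) - g (N + Suc k)) \<longlonglongrightarrow> L - L"
    by (intro tendsto_diff L) (use LIMSEQ_Suc[OF L] in simp)
  then have "\<forall>\<^sub>F k in sequentially. g (N + k) - g (N + Suc k) < h / (2 * K)"
    by (rule order_tendstoD) (use h K in simp)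
  then obtain k0 where k0: "\<And>k. k \<ge> k0 \<Longrightarrow> g (N + k) - g (N + Suc k) < h / (2 * K)"
    by (auto simp: eventually_sequentially)
  have Gdec: "G (Suc (N + k)) \<le> G (N + k)" if "k \<ge> k0" for k
    using dec[of "N + k"] gN[of k] k0[OF that] by force
  have Gbd: "G (N + k0 + j) \<le> G (N + k0)" for j
  proof (induction j)
    case (Suc j)
    then show ?case using Gdec[of "k0 + j"] by (simp add: add.assoc)
  qed simp
  \<comment> \<open>At such a range, with \<open>G\<close> no longer growing,
    \<open>l * G n + c - R n / 2\<close> is negative and the range is stuck.\<close>
  obtain m where m: "R m > 2 * (l * G (N + k0) + c)" using unb by blast
  define M where "M = max m (N + k0)"
  have stuck: "R (M + j) \<le> R M" for j
  proof (induction j)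
    case (Suc j)
    have "l * G (M + j) \<le> l * G (N + k0)"
      using Gbd[of "M + j - (N + k0)"] l by (simp add: M_def)
    moreover have "R m \<le> R (M + j)" by (rule mono) (simp add: M_def)
    ultimately have "R (Suc (M + j)) \<le> R (M + j)" using step[of "M + j"] m by auto
    then show ?case using Suc by simp
  qed simp
  have "R n \<le> R M" for n
    using stuck[of "n - M"] mono[of n M] by (cases "n \<le> M") auto
  then show False using unb by (meson not_le)
qed

text \<open>\<open>G\<close> bounds the largest gap: each point of the current range lies within
  \<open>G k\<close> of a visited one. A new state inside the range is therefore close to an earlier
  one; a state outside is as far from the crossed end as the range is extended. Either way the next
  overshoot is at most \<open>l * G + c - R / 2\<close>.\<close>

lemma one_dim_steered_bounded:
  fixes y :: "nat \<Rightarrow> real"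
  assumes l: "l > 0" "l\<^sup>2 - 3 * l + 1 / 4 < 0" and "N \<ge> 1"
    and step: "\<And>n j. n \<ge> N \<Longrightarrow> j < n \<Longrightarrow> \<bar>y (Suc n) - running_mid y n\<bar> \<le> l * \<bar>y n - y j\<bar> + c"
  shows "\<exists>B. \<forall>n. \<bar>y n - y 0\<bar> \<le> B"
proof -
  define R where "R = running_range y"
  \<comment> \<open>The gap bound starts with the full range at time \<open>N\<close>, for which any
    visited point serves; afterwards only an extension of the range can create a larger gap.\<close>
  define G where "G = rec_nat (R N) (\<lambda>k g. max g (R (Suc (N + k)) - R (N + k)))"
  have G0: "G 0 = R N" and GS: "G (Suc k) = max (G k) (R (Suc (N + k)) - R (N + k))" for k
    by (simp_all add: G_def)
  have Gpos: "0 \<le> G k" for k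
    by (induction k) (auto simp: G0 GS R_def running_range_nonneg le_max_iff_disj)
  have covered: "\<exists>j\<le>N + k. \<bar>z - y j\<bar> \<le> G k"
    if "running_min y (N + k) \<le> z" "z \<le> running_max y (N + k)" for z k
    using that
  proof (induction k arbitrary: z)
    case 0
    then have "\<bar>z - y N\<bar> \<le> G 0"
      using running_max_ge[of N N y] running_min_le[of N N y]
      by (auto simp: G0 R_def running_range_def)
    then show ?case by auto
  next
    case (Suc k)
    consider "running_min y (N + k) \<le> z" "z \<le> running_max y (N + k)"
      | "z < running_min y (N + k)" | "z > running_max y (N + k)" by linarith
    then show ?case
    proof cases
      case 1
      then show ?thesis using Suc.IH[of z] GS[of k] by (auto simp: le_max_iff_disj intro: le_SucI)
    next
      case 2
      obtain j where j: "j \<le> N + k" "y j = running_min y (N + k)" by (rule running_min_attained)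
      have "\<bar>z - y j\<bar> \<le> R (Suc (N + k)) - R (N + k)"
        using 2 j Suc.prems by (auto simp: R_def running_range_def running_max_Suc running_min_Suc)
      then show ?thesis using j GS[of k] by (intro exI[of _ j]) auto
    next
      case 3
      obtain j where j: "j \<le> N + k" "y j = running_max y (N + k)" by (rule running_max_attained)
      have "\<bar>z - y j\<bar> \<le> R (Suc (N + k)) - R (N + k)"
        using 3 j Suc.prems by (auto simp: R_def running_range_def running_max_Suc running_min_Suc)
      then show ?thesis using j GS[of k] by (intro exI[of _ j]) auto
    qed
  qed
  \<comment> \<open>\<open>covered\<close> at \<open>Suc k\<close> might return the new state
    itself, while the controller compares with strictly earlier states.\<close>
  have near: "\<exists>j\<le>N + k. \<bar>y (Suc (N + k)) - y j\<bar> \<le> G (Suc k)" for k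
  proof -
    let ?z = "y (Suc (N + k))"
    consider "running_min y (N + k) \<le> ?z" "?z \<le> running_max y (N + k)"
      | "?z < running_min y (N + k)" | "?z > running_max y (N + k)" by linarith
    then show ?thesis
    proof cases
      case 1
      then show ?thesis using covered[of k ?z] GS[of k] by (auto simp: le_max_iff_disj)
    next
      case 2
      obtain j where j: "j \<le> N + k" "y j = running_min y (N + k)" by (rule running_min_attained)
      have "\<bar>?z - y j\<bar> \<le> R (Suc (N + k)) - R (N + k)"
        using 2 j by (auto simp: R_def running_range_def running_max_Suc running_min_Suc)
      then show ?thesis using j GS[of k] by (intro exI[of _ j]) auto
    next
      case 3
      obtain j where j: "j \<le> N + k" "y j = running_max y (N + k)" by (rule running_max_attained)
      have "\<bar>?z - y j\<bar> \<le> R (Suc (N + k)) - R (N + k)"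
        using 3 j by (auto simp: R_def running_range_def running_max_Suc running_min_Suc)
      then show ?thesis using j GS[of k] by (intro exI[of _ j]) auto
    qed
  qed
  have grow: "R (Suc (Suc (N + k))) \<le> R (Suc (N + k))
      + max 0 (l * G (Suc k) + c - R (Suc (N + k)) / 2)" for k
  proof -
    let ?n = "Suc (N + k)"
    obtain j where j: "j \<le> N + k" "\<bar>y ?n - y j\<bar> \<le> G (Suc k)" using near by blast
    have "\<bar>y (Suc ?n) - running_mid y ?n\<bar> \<le> l * \<bar>y ?n - y j\<bar> + c"
      by (rule step) (use j in auto)
    also have "\<dots> \<le> l * G (Suc k) + c" using j l by simp
    finally show ?thesis using running_range_Suc_le[of y ?n] by (auto simp: R_def)
  qed
  \<comment> \<open>The recursion starts at time \<open>Suc N\<close>, the first for which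
    \<open>near\<close> provides an earlier state.\<close>
  have "\<exists>B. \<forall>k. R (Suc (N + k)) \<le> B"
    by (rule range_gap_recursion_bounded[OF l, of "\<lambda>k. R (Suc (N + k))" "\<lambda>k. G (Suc k)" c])
      (use grow Gpos GS[of "Suc _"] in \<open>auto simp: R_def running_range_Suc_ge\<close>)
  then obtain B where B: "\<And>k. R (Suc (N + k)) \<le> B" by blast
  have "\<bar>y n - y 0\<bar> \<le> B" for n
    using diff_le_running_range[of n "Suc (N + n)" y] B[of n] by (simp add: R_def)
  then show ?thesis by blast
qed

lemma winning_histories_dim_one_empty:
  assumes l: "l > 0" "l\<^sup>2 - 3 * l + 1 / 4 < 0"
  shows "(winning_histories l :: (real ^ 1) history set) = {}"
proof (rule ccontr)
  define p :: "(real ^ 1) list \<Rightarrow> real ^ 1" where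
    "p xs = (\<chi> _. running_mid (\<lambda>i. (xs ! i) $ 1) (length xs - 1))" for xs
  assume "(winning_histories l :: (real ^ 1) history set) \<noteq> {}"
  then obtain x :: "nat \<Rightarrow> real ^ 1" and c N where "N \<ge> 1" and
    x: "\<And>n j. n \<ge> N \<Longrightarrow> j < n \<Longrightarrow>
       norm (x (Suc n) - p (map x [0..<Suc n])) \<le> l * norm (x n - x j) + c"
    and unb: "\<And>B. \<exists>n. B < norm (x n - x 0)"
    using nearest_neighbour_controller[of l p] l by (metis less_imp_le)
  define y where "y n = x n $ 1" for n
  have norm1: "norm v = \<bar>v $ 1\<bar>" for v :: "real ^ 1" by (simp add: norm_real)
  have p: "p (map x [0..<Suc n]) $ 1 = running_mid y n" for n
  proof -
    have "(\<lambda>i. map x [0..<Suc n] ! i $ 1) ` {..n} = y ` {..n}"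
      by (intro image_cong) (auto simp: y_def less_Suc_eq_le simp del: upt_Suc)
    then show ?thesis
      by (simp add: p_def running_mid_def running_max_def running_min_def del: upt_Suc)
  qed
  have "\<exists>B. \<forall>n. \<bar>y n - y 0\<bar> \<le> B"
    by (rule one_dim_steered_bounded[OF l \<open>N \<ge> 1\<close>, of y c])
      (use x in \<open>auto simp: norm1 p y_def simp del: upt_Suc\<close>)
  then show False using unb by (auto simp: norm1 y_def) (meson not_le)
qed

section \<open>The expanding adversary\<close>

text \<open>\<open>y\<close> and \<open>\<rho>\<close> are coordinates of states and responses along
  a line, \<open>v\<close> is the move of the controller and \<open>v + t\<close> the next state.
  The first condition keeps the envelope at 0, the second pushes the next state away from the
  midpoint.\<close>

definition expanding_response ::
  "real \<Rightarrow> nat \<Rightarrow> (nat \<Rightarrow> real) \<Rightarrow> (nat \<Rightarrow> real) \<Rightarrow> real \<Rightarrow> real \<Rightarrow> bool" where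
  "expanding_response l n y \<rho> v t \<longleftrightarrow>
     (\<forall>j<n. \<bar>t - \<rho> j\<bar> \<le> l * \<bar>y n - y j\<bar>) \<and>
     l * (running_range y n - running_range y (n - 1)) \<le> \<bar>v + t - running_mid y n\<bar>"

lemma expanding_response_cong:
  assumes "\<And>i. i \<le> n \<Longrightarrow> y i = y' i" "\<And>i. i < n \<Longrightarrow> \<rho> i = \<rho>' i"
  shows "expanding_response l n y \<rho> v t = expanding_response l n y' \<rho>' v t"
proof -
  have "y ` {..m} = y' ` {..m}" if "m \<le> n" for m
    using assms that by (intro image_cong) auto
  from this[of n] this[of "n - 1"] show ?thesis
    using assms by (simp add: expanding_response_def running_range_def running_mid_def
        running_max_def running_min_def)
qed

text \<open>Let \<open>d\<close> be the last extension and \<open>y i\<close> the end of the old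
  range that was crossed. Going out by \<open>d\<close> adds exactly \<open>d\<close> to the
  distance from each earlier state, so both \<open>\<rho> i + l * d\<close> and
  \<open>\<rho> i - l * d\<close> are admissible; the sign is chosen to lead away from the
  midpoint.\<close>

lemma ex_expanding_response:
  assumes "l \<ge> 0"
    and lip: "\<And>i j. i \<le> n \<Longrightarrow> j \<le> n \<Longrightarrow> \<bar>\<rho> i - \<rho> j\<bar> \<le> l * \<bar>y i - y j\<bar>"
    and outside: "y (Suc n) < running_min y n \<or> running_max y n < y (Suc n)"
  shows "\<exists>t. expanding_response l (Suc n) y \<rho> v t"
proof -
  define d where "d = running_range y (Suc n) - running_range y n"
  obtain i where i: "i \<le> n" "\<And>j. j \<le> n \<Longrightarrow> \<bar>y (Suc n) - y j\<bar> = d + \<bar>y i - y j\<bar>"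
  proof -
    from outside show thesis
    proof
      assume *: "y (Suc n) < running_min y n"
      obtain i where i: "i \<le> n" "y i = running_min y n" by (rule running_min_attained)
      have "\<bar>y (Suc n) - y j\<bar> = d + \<bar>y i - y j\<bar>" if "j \<le> n" for j
        using * i running_min_le[OF that, of y] running_max_ge[OF that, of y]
        by (auto simp: d_def running_range_def running_max_Suc running_min_Suc)
      then show thesis using i that by blast
    next
      assume *: "running_max y n < y (Suc n)"
      obtain i where i: "i \<le> n" "y i = running_max y n" by (rule running_max_attained)
      have "\<bar>y (Suc n) - y j\<bar> = d + \<bar>y i - y j\<bar>" if "j \<le> n" for j
        using * i running_min_le[OF that, of y] running_max_ge[OF that, of y]
        by (auto simp: d_def running_range_def running_max_Suc running_min_Suc)
      then show thesis using i that by blast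
    qed
  qed
  have d: "0 \<le> l * d" using assms(1) running_range_Suc_ge[of y n] by (simp add: d_def)
  define t where "t = \<rho> i + (if v + \<rho> i - running_mid y (Suc n) \<ge> 0 then l * d else - l * d)"
  have "\<bar>t - \<rho> j\<bar> \<le> l * \<bar>y (Suc n) - y j\<bar>" if "j \<le> n" for j
  proof -
    have "\<bar>t - \<rho> j\<bar> \<le> l * d + \<bar>\<rho> i - \<rho> j\<bar>" using d by (auto simp: t_def)
    also have "\<dots> \<le> l * (d + \<bar>y i - y j\<bar>)" using lip[OF i(1) that] by (simp add: distrib_left)
    finally show ?thesis using i(2)[OF that] by simp
  qed
  moreover have "l * d \<le> \<bar>v + t - running_mid y (Suc n)\<bar>" using d by (auto simp: t_def)
  ultimately show ?thesis
    by (intro exI[of _ t]) (auto simp: expanding_response_def d_def less_Suc_eq_le)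
qed

text \<open>\<open>resp\<close> models a choice operator: \<open>\<rho>\<close> is admissible
  whenever some value is. With \<open>q = sqrt l\<close> and consecutive ranges \<open>R\<close>,
  \<open>R'\<close> satisfying \<open>q * R \<le> R'\<close>, the next range is at least
  \<open>(l + 1 / 2) * R' - l * R\<close>, hence at least
  \<open>2 * q * R' - q * R' = q * R'\<close>, so geometric growth propagates.\<close>

lemma expanding_play_unbounded:
  fixes y \<rho> v :: "nat \<Rightarrow> real"
  assumes l: "l > 1" "l + 1 / 2 \<ge> 2 * sqrt l"
    and init: "y 0 = 0" "y 1 = 1" "\<rho> 0 = 0"
    and resp: "\<And>n t. expanding_response l (Suc n) y \<rho> (v (Suc n)) t \<Longrightarrow>
      expanding_response l (Suc n) y \<rho> (v (Suc n)) (\<rho> (Suc n))"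
    and step: "\<And>n. y (Suc (Suc n)) = v (Suc n) + \<rho> (Suc n)"
  shows "\<bar>\<rho> i - \<rho> j\<bar> \<le> l * \<bar>y i - y j\<bar>" and "\<exists>n. B < \<bar>y n - y 0\<bar>"
proof -
  define q where "q = sqrt l"
  have q: "q > 1" "l = q * q" "l + 1 / 2 \<ge> 2 * q" using l by (auto simp: q_def)
  let ?R = "running_range y"
  \<comment> \<open>That each state leaves the previous range belongs to the invariant because it
    guarantees an admissible next response.\<close>
  have inv: "(\<forall>i\<le>n. \<forall>j\<le>n. \<bar>\<rho> i - \<rho> j\<bar> \<le> l * \<bar>y i - y j\<bar>)
      \<and> (y (Suc n) < running_min y n \<or> running_max y n < y (Suc n))
      \<and> q * ?R n \<le> ?R (Suc n) \<and> 0 < ?R (Suc n)" for n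
  proof (induction n)
    case 0
    show ?case using init
      by (auto simp: running_range_def running_max_def running_min_def atMost_Suc)
  next
    case (Suc n)
    then have lip: "\<And>i j. i \<le> n \<Longrightarrow> j \<le> n \<Longrightarrow> \<bar>\<rho> i - \<rho> j\<bar> \<le> l * \<bar>y i - y j\<bar>"
      and outside: "y (Suc n) < running_min y n \<or> running_max y n < y (Suc n)"
      and R: "q * ?R n \<le> ?R (Suc n)" "0 < ?R (Suc n)" by auto
    have "expanding_response l (Suc n) y \<rho> (v (Suc n)) (\<rho> (Suc n))"
      using ex_expanding_response[OF _ lip outside] resp l by (metis less_eq_real_def less_trans zero_less_one)
    then have lip': "\<And>j. j \<le> n \<Longrightarrow> \<bar>\<rho> (Suc n) - \<rho> j\<bar> \<le> l * \<bar>y (Suc n) - y j\<bar>"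
      and far: "l * (?R (Suc n) - ?R n) \<le> \<bar>y (Suc (Suc n)) - running_mid y (Suc n)\<bar>"
      by (auto simp: expanding_response_def step less_Suc_eq_le)
    have "q * (q * ?R n) \<le> q * ?R (Suc n)" using R(1) q by (intro mult_left_mono) auto
    then have "l * ?R n \<le> q * ?R (Suc n)" using q by simp
    moreover have "2 * q * ?R (Suc n) \<le> (l + 1 / 2) * ?R (Suc n)" using q R by (intro mult_right_mono) auto
    ultimately have ge: "q * ?R (Suc n) \<le> l * (?R (Suc n) - ?R n) + ?R (Suc n) / 2"
      by (simp add: algebra_simps)
    have "1 * ?R (Suc n) < q * ?R (Suc n)" using q R by (intro mult_strict_right_mono) auto
    then have out: "?R (Suc n) / 2 < \<bar>y (Suc (Suc n)) - running_mid y (Suc n)\<bar>"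
      using ge far by simp
    have "?R (Suc (Suc n)) = \<bar>y (Suc (Suc n)) - running_mid y (Suc n)\<bar> + ?R (Suc n) / 2"
      by (rule running_range_Suc_outside) (use out in simp)
    then have "q * ?R (Suc n) \<le> ?R (Suc (Suc n))" "0 < ?R (Suc (Suc n))"
      using ge far R out by auto
    moreover have "y (Suc (Suc n)) < running_min y (Suc n) \<or> running_max y (Suc n) < y (Suc (Suc n))"
      using out by (auto simp: running_range_def running_mid_def abs_if field_simps split: if_splits)
    moreover have "\<forall>i\<le>Suc n. \<forall>j\<le>Suc n. \<bar>\<rho> i - \<rho> j\<bar> \<le> l * \<bar>y i - y j\<bar>"
      using lip lip' by (auto simp: le_Suc_eq abs_minus_commute)
    ultimately show ?case by blast
  qed
  show "\<bar>\<rho> i - \<rho> j\<bar> \<le> l * \<bar>y i - y j\<bar>"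
    using inv[of "max i j"] by auto
  have "q ^ n \<le> ?R (Suc n)" for n
  proof (induction n)
    case 0
    show ?case using init
      by (auto simp: running_range_def running_max_def running_min_def atMost_Suc)
  next
    case (Suc n)
    have "q * q ^ n \<le> q * ?R (Suc n)" using Suc q by (intro mult_left_mono) auto
    then show ?case using inv[of "Suc n"] by simp
  qed
  \<comment> \<open>A range above \<open>2 * B\<close> has an end at distance more than
    \<open>B\<close> from \<open>y 0\<close>.\<close>
  moreover obtain n where "2 * B < q ^ n" using real_arch_pow[OF q(1)] by blast
  ultimately have "2 * B < ?R (Suc n)" by (meson less_le_trans)
  moreover obtain i where "y i = running_max y (Suc n)" by (rule running_max_attained)
  moreover obtain j where "y j = running_min y (Suc n)" by (rule running_min_attained)
  ultimately have "B < \<bar>y i - y 0\<bar> \<or> B < \<bar>y j - y 0\<bar>" by (auto simp: running_range_def)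
  then show "\<exists>n. B < \<bar>y n - y 0\<bar>" by blast
qed

text \<open>The adversary looks at one coordinate and answers along a unit vector \<open>e\<close>.
  Projection onto \<open>e\<close> does not increase distances, so the Lipschitz bound on the line,
  with error 0, and the unboundedness carry over to norms.\<close>

lemma winning_histories_nonempty:
  assumes l: "l > 1" "l + 1 / 2 \<ge> 2 * sqrt l"
  shows "(winning_histories l :: 'a::euclidean_space history set) \<noteq> {}"
proof -
  obtain e :: 'a where e: "e \<in> Basis" using nonempty_Basis by blast
  then have [simp]: "norm e = 1" "e \<bullet> e = 1" by simp_all
  \<comment> \<open>Two states and one response are prescribed so that the range is already 1 and
    the second state lies outside the range of the first.\<close>
  define H0 :: "'a history" where "H0 = ([0, e], [0])"
  define \<sigma> :: "'a adversary" where "\<sigma> = (\<lambda>((xs, rs), u).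
    (SOME t. expanding_response l (length rs) (\<lambda>i. xs ! i \<bullet> e) (\<lambda>i. rs ! i \<bullet> e) (u \<bullet> e) t) *\<^sub>R e)"
  have \<sigma>: "\<sigma> ((xs, rs), u) =
      (SOME t. expanding_response l (length rs) (\<lambda>i. xs ! i \<bullet> e) (\<lambda>i. rs ! i \<bullet> e) (u \<bullet> e) t) *\<^sub>R e"
    for xs rs u by (simp add: \<sigma>_def)
  have "resulting_play \<mu> \<sigma> H0 \<in> Esc l H0" for \<mu>
  proof -
    have H0: "response_history H0" "length (snd H0) = 1" by (simp_all add: H0_def response_history_def)
    let ?H = "history_at \<mu> \<sigma> H0"
    obtain x r where H: "\<And>k. ?H k = (map x [0..<Suc (1 + k)], map r [0..<1 + k])"
      and r: "\<And>k. r (1 + k) = \<sigma> (?H k, \<mu> (?H k))"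
      and x: "\<And>k. x (Suc (1 + k)) = \<mu> (?H k) + r (1 + k)"
      using history_at_sequences[OF H0(1)] unfolding H0(2) by metis
    define y where "y i = x i \<bullet> e" for i
    define \<rho> where "\<rho> i = r i \<bullet> e" for i
    \<comment> \<open>The response with index \<open>n\<close> is chosen at stage
      \<open>n - 1\<close>, since \<open>H0\<close> already contains one response.\<close>
    define v where "v n = \<mu> (?H (n - 1)) \<bullet> e" for n
    have 0: "x 0 = 0" "x 1 = e" "r 0 = 0" using H[of 0] by (simp_all add: H0_def)
    have rS: "r (Suc n) = (SOME t. expanding_response l (Suc n) y \<rho> (v (Suc n)) t) *\<^sub>R e" for n
    proof -
      have "expanding_response l (length (map r [0..<1 + n])) (\<lambda>i. map x [0..<Suc (1 + n)] ! i \<bullet> e)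
          (\<lambda>i. map r [0..<1 + n] ! i \<bullet> e) (\<mu> (?H n) \<bullet> e) t
        = expanding_response l (Suc n) y \<rho> (v (Suc n)) t" for t
        by (simp add: v_def del: upt_Suc, rule expanding_response_cong)
          (auto simp: y_def \<rho>_def less_Suc_eq_le simp del: upt_Suc)
      then show ?thesis using r[of n] H[of n] by (simp add: \<sigma> del: upt_Suc)
    qed
    have re: "r n = \<rho> n *\<^sub>R e" for n
      by (cases n) (simp_all add: 0 \<rho>_def rS)
    have "expanding_response l (Suc n) y \<rho> (v (Suc n)) (\<rho> (Suc n))"
      if "expanding_response l (Suc n) y \<rho> (v (Suc n)) t" for n t
      using someI[of "expanding_response l (Suc n) y \<rho> (v (Suc n))", OF that] rS[of n]
      by (simp add: \<rho>_def)
    moreover have "y (Suc (Suc n)) = v (Suc n) + \<rho> (Suc n)" for n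
      using x[of n] by (simp add: y_def v_def \<rho>_def inner_add_left)
    moreover have "y 0 = 0" "y 1 = 1" "\<rho> 0 = 0" by (simp_all only: y_def \<rho>_def 0) simp_all
    ultimately have lip: "\<bar>\<rho> i - \<rho> j\<bar> \<le> l * \<bar>y i - y j\<bar>" and unb: "\<exists>n. B < \<bar>y n - y 0\<bar>" for i j B
      using expanding_play_unbounded[OF l, of y \<rho> v] by blast+
    have y_le: "\<bar>y i - y j\<bar> \<le> norm (x i - x j)" for i j
      using Cauchy_Schwarz_ineq2[of "x i - x j" e] by (simp add: y_def inner_diff_left)
    have "norm (r i - r j) \<le> l * norm (x i - x j) + 0" for i j
    proof -
      have "norm (r i - r j) = \<bar>\<rho> i - \<rho> j\<bar>" by (simp add: re flip: scaleR_diff_left)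
      also have "\<dots> \<le> l * \<bar>y i - y j\<bar>" by (rule lip)
      also have "\<dots> \<le> l * norm (x i - x j)" using l by (intro mult_left_mono y_le) auto
      finally show ?thesis by simp
    qed
    moreover have "\<exists>n. B < norm (x n - x 0)" for B
      using unb[of B] y_le by (meson less_le_trans)
    ultimately show ?thesis
      unfolding resulting_play_in_Esc_iff[of \<mu> \<sigma> H0 x 1 r, OF H] by blast
  qed
  moreover have "response_history H0" by (simp add: H0_def response_history_def)
  ultimately have "H0 \<in> winning_histories l"
    by (auto simp: winning_histories_def adversary_wins_def)
  then show ?thesis by blast
qed

section \<open>Radial integrals and a divergence identity on balls\<close>

text \<open>Polar coordinates: for \<open>0 \<le> r\<close> both measures give \<open>{..r}\<close>
  the volume \<open>unit_ball_vol DIM('a) * r ^ DIM('a)\<close> of a ball, whose derivative is the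
  density, and half-lines generate the Borel sets.\<close>

lemma distr_norm_lborel:
  "distr (lborel :: 'a::euclidean_space measure) borel norm =
     density lborel (\<lambda>r. ennreal (DIM('a) * unit_ball_vol DIM('a) * r ^ (DIM('a) - 1)) * indicator {0..} r)"
  (is "?M = ?N")
proof (rule measure_eqI_generator_eq[where \<Omega> = UNIV and E = "range (\<lambda>a::real. {..a})" and A = "\<lambda>i. {..real i}"])
  let ?v = "unit_ball_vol DIM('a)"
  have M: "emeasure ?M {..r} = (if r < 0 then 0 else ennreal (?v * r ^ DIM('a)))" for r
  proof -
    have "norm -` {..r} = (cball 0 r :: 'a set)" by (auto simp: cball_def)
    then show ?thesis by (simp add: emeasure_distr emeasure_cball)
  qed
  have N: "emeasure ?N {..r} = (if r < 0 then 0 else ennreal (?v * r ^ DIM('a)))" for r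
  proof -
    have "emeasure ?N {..r} = (\<integral>\<^sup>+x. ennreal (DIM('a) * ?v * x ^ (DIM('a) - 1)) * indicator {0..r} x \<partial>lborel)"
      by (subst emeasure_density) (simp, simp, simp, intro nn_integral_cong, simp split: split_indicator)
    also have "\<dots> = (if r < 0 then 0 else ennreal (?v * r ^ DIM('a)))"
    proof (cases "r < 0")
      case False
      have D: "((\<lambda>x. ?v * x ^ DIM('a)) has_real_derivative DIM('a) * ?v * x ^ (DIM('a) - 1)) (at x)" for x
        using DERIV_cmult[OF DERIV_pow[of "DIM('a)" x], of ?v] by (simp add: mult_ac)
      have "(\<integral>\<^sup>+x. ennreal (DIM('a) * ?v * x ^ (DIM('a) - 1)) * indicator {0..r} x \<partial>lborel)
          = ennreal (?v * r ^ DIM('a) - ?v * 0 ^ DIM('a))"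
        by (rule nn_integral_FTC_Icc[OF _ D]) (use False in \<open>simp_all\<close>)
      then show ?thesis using False by simp
    qed simp
    finally show ?thesis .
  qed
  show "emeasure ?M X = emeasure ?N X" if "X \<in> range (\<lambda>a::real. {..a})" for X
    using that by (elim rangeE) (simp only: M N)
  show "emeasure ?M {..real i} \<noteq> \<infinity>" for i by (simp add: M)
  show "Int_stable (range (\<lambda>a::real. {..a}))" by (auto simp: Int_stable_def)
  have s: "sigma_sets UNIV (range (\<lambda>a::real. {..a})) = sets borel"
    by (subst borel_eq_atMost) simp
  show "sets ?M = sigma_sets UNIV (range (\<lambda>a::real. {..a}))"
    "sets ?N = sigma_sets UNIV (range (\<lambda>a::real. {..a}))"
    by (simp_all only: s sets_distr sets_density sets_lborel)
  have "x \<in> (\<Union>i. {..real i})" for x :: real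
    using real_arch_simple[of x] by blast
  then show "(\<Union>i. {..real i}) = UNIV" by blast
  show "range (\<lambda>a::real. {..a}) \<subseteq> Pow UNIV" by simp
  show "range (\<lambda>i. {..real i}) \<subseteq> range (\<lambda>a::real. {..a})" by blast
qed

lemma nn_integral_radial:
  fixes f :: "real \<Rightarrow> ennreal"
  assumes [measurable]: "f \<in> borel_measurable borel"
  shows "(\<integral>\<^sup>+z. f (norm (z::'a::euclidean_space)) \<partial>lborel) =
    (\<integral>\<^sup>+r. ennreal (DIM('a) * unit_ball_vol DIM('a) * r ^ (DIM('a) - 1)) * indicator {0..} r * f r \<partial>lborel)"
proof -
  have "(\<integral>\<^sup>+z. f (norm (z::'a)) \<partial>lborel) = integral\<^sup>N (distr (lborel :: 'a measure) borel norm) f"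
    by (subst nn_integral_distr) auto
  also have "\<dots> = (\<integral>\<^sup>+r. ennreal (DIM('a) * unit_ball_vol DIM('a) * r ^ (DIM('a) - 1)) * indicator {0..} r * f r \<partial>lborel)"
    unfolding distr_norm_lborel by (subst nn_integral_density) auto
  finally show ?thesis .
qed

text \<open>
  The integral of a difference quotient of the extension of \<open>G\<close> by \<open>0\<close> vanishes by translation
  invariance; the extension is Lipschitz because it is \<open>G\<close> composed with the projection onto the ball.
\<close>

lemma integral_cball_derivative_eq_0:
  fixes G :: "'a::euclidean_space \<Rightarrow> real" and D :: "'a \<Rightarrow> 'a \<Rightarrow> real"
  assumes \<tau>: "\<tau> > 0"
    and deriv: "\<And>z. norm z \<le> \<tau> \<Longrightarrow> (G has_derivative D z) (at z)"
    and cont: "continuous_on (cball 0 \<tau> \<times> cball 0 1) (\<lambda>(z, v). D z v)"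
    and bdry: "\<And>z. norm z = \<tau> \<Longrightarrow> G z = 0"
    and v: "norm v \<le> 1"
  shows "integrable lborel (\<lambda>z. indicator (cball 0 \<tau>) z *\<^sub>R D z v)"
    and "(\<integral>z. indicator (cball 0 \<tau>) z *\<^sub>R D z v \<partial>lborel) = 0"
proof -
  let ?S = "cball 0 \<tau> :: 'a set"
  have "compact ((\<lambda>(z, v). D z v) ` (?S \<times> cball 0 1))"
    by (intro compact_continuous_image cont compact_Times compact_cball)
  then have "bounded ((\<lambda>(z, v). D z v) ` (?S \<times> cball 0 1))" by (rule compact_imp_bounded)
  then obtain B where "B > 0" and B': "\<forall>u\<in>(\<lambda>(z, v). D z v) ` (?S \<times> cball 0 1). norm u \<le> B"
    unfolding bounded_pos by blast
  have B: "\<bar>D z v\<bar> \<le> B" if "norm z \<le> \<tau>" "norm v \<le> 1" for z v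
    using bspec[OF B' imageI[of "(z, v)"]] that by simp
  have lin: "linear (D z)" if "norm z \<le> \<tau>" for z
    using deriv[OF that] by (rule has_derivative_linear)
  have onorm: "onorm (D z) \<le> B" if z: "norm z \<le> \<tau>" for z
  proof (rule onorm_le)
    fix w
    show "norm (D z w) \<le> B * norm w"
    proof (cases "w = 0")
      case True
      then show ?thesis using linear_0[OF lin[OF z]] by simp
    next
      case False
      have "D z w = norm w * D z (w /\<^sub>R norm w)"
        using False linear_scale[OF lin[OF z], of "inverse (norm w)" w] by simp
      then show ?thesis using B[OF z, of "w /\<^sub>R norm w"] False
        by (simp add: abs_mult mult.commute)
    qed
  qed
  have lipG: "\<bar>G z - G z'\<bar> \<le> B * norm (z - z')" if "z \<in> ?S" "z' \<in> ?S" for z z'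
  proof -
    have "norm (G z - G z') \<le> B * norm (z - z')"
      by (rule differentiable_bound[of ?S G D])
        (use deriv onorm that in \<open>auto intro: has_derivative_at_withinI\<close>)
    then show ?thesis by simp
  qed
  define g where "g = (\<lambda>z. indicator ?S z *\<^sub>R G z)"
  \<comment> \<open>Outside the ball the closest point lies on the sphere, where \<open>G\<close>
    vanishes by \<open>bdry\<close>.\<close>
  have g_proj: "g z = G (closest_point ?S z)" for z
  proof (cases "z \<in> ?S")
    case True
    then show ?thesis by (simp add: g_def closest_point_self)
  next
    case False
    have "interior ?S \<noteq> {}" using \<tau> by simp
    then have "closest_point ?S z \<in> rel_frontier ?S"
      using False by (intro closest_point_in_rel_frontier)
        (auto simp: affine_hull_nonempty_interior rel_interior_nonempty_interior)
    moreover have "rel_frontier ?S = sphere 0 \<tau>"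
      using \<open>interior ?S \<noteq> {}\<close> \<tau> by (simp add: rel_frontier_nonempty_interior)
    ultimately have "norm (closest_point ?S z) = \<tau>" by simp
    then show ?thesis using False bdry by (simp add: g_def)
  qed
  have lipg: "\<bar>g z - g z'\<bar> \<le> B * norm (z - z')" for z z'
  proof -
    have "\<bar>g z - g z'\<bar> \<le> B * norm (closest_point ?S z - closest_point ?S z')"
      unfolding g_proj by (intro lipG closest_point_in_set) (use \<tau> in auto)
    also have "\<dots> \<le> B * norm (z - z')"
      using closest_point_lipschitz[of ?S z z'] \<tau> \<open>B > 0\<close> by (simp add: dist_norm)
    finally show ?thesis .
  qed
  have contG: "continuous_on ?S G"
    by (intro continuous_at_imp_continuous_on ballI has_derivative_continuous[OF deriv]) simp
  have intg: "integrable lborel g" unfolding g_def by (rule borel_integrable_compact) (use contG in auto)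
  then have gm [measurable]: "g \<in> borel_measurable borel" by auto
  have shift: "integrable lborel (\<lambda>z. g (w + z))" "(\<integral>z. g (w + z) \<partial>lborel) = (\<integral>z. g z \<partial>lborel)" for w
  proof -
    have "integrable (distr lborel borel ((+) w)) g" using intg by (simp add: lborel_distr_plus)
    then show "integrable lborel (\<lambda>z. g (w + z))" by (subst (asm) integrable_distr_eq) auto
    have "(\<integral>z. g z \<partial>lborel) = (\<integral>z. g z \<partial>distr lborel borel ((+) w))" by (simp add: lborel_distr_plus)
    also have "\<dots> = (\<integral>z. g (w + z) \<partial>lborel)" by (subst integral_distr) auto
    finally show "(\<integral>z. g (w + z) \<partial>lborel) = (\<integral>z. g z \<partial>lborel)" by simp
  qed
  \<comment> \<open>Steps of size at most 1 keep the supports of all quotients in the ball of radius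
    \<open>\<tau> + 1\<close>, where the Lipschitz constant dominates them.\<close>
  define t where "t k = 1 / real (Suc k)" for k
  have t: "0 < t k" "t k \<le> 1" for k by (simp_all add: t_def field_simps)
  have t0: "t \<longlonglongrightarrow> 0" unfolding t_def using LIMSEQ_inverse_real_of_nat by (simp add: inverse_eq_divide)
  define Q where "Q k z = (g (t k *\<^sub>R v + z) - g z) / t k" for k z
  have Q0: "(\<integral>z. Q k z \<partial>lborel) = 0" for k
    unfolding Q_def using shift intg by (simp add: Bochner_Integration.integral_diff)
  have fm: "(\<lambda>z. indicator ?S z *\<^sub>R D z v) \<in> borel_measurable lborel"
  proof -
    have "continuous_on ?S (\<lambda>z. (\<lambda>(z, v). D z v) (z, v))"
      by (rule continuous_on_compose2[OF cont]) (use v in \<open>auto intro!: continuous_intros\<close>)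
    then show ?thesis using borel_measurable_continuous_on_indicator[of ?S "\<lambda>z. D z v"] by simp
  qed
  have Qm: "Q k \<in> borel_measurable lborel" for k unfolding Q_def by measurable
  have wint: "integrable lborel (\<lambda>z. indicator (cball 0 (\<tau> + 1)) z *\<^sub>R B :: real)"
    by (rule borel_integrable_compact) auto
  have bound: "AE z in lborel. norm (Q k z) \<le> indicator (cball 0 (\<tau> + 1)) z *\<^sub>R B" for k
  proof (rule AE_I2)
    fix z
    have tv: "norm (t k *\<^sub>R v) \<le> t k" using t[of k] v by (simp add: mult_left_le)
    show "norm (Q k z) \<le> indicator (cball 0 (\<tau> + 1)) z *\<^sub>R B"
    proof (cases "z \<in> cball 0 (\<tau> + 1)")
      case True
      have "\<bar>g (t k *\<^sub>R v + z) - g z\<bar> \<le> B * norm (t k *\<^sub>R v)" using lipg[of "t k *\<^sub>R v + z" z] by simp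
      also have "\<dots> \<le> B * t k" using tv \<open>B > 0\<close> by simp
      finally show ?thesis using True t[of k] by (simp add: Q_def field_simps)
    next
      case False
      have "norm z \<le> norm (t k *\<^sub>R v + z) + norm (t k *\<^sub>R v)"
        using norm_triangle_ineq4[of "t k *\<^sub>R v + z" "t k *\<^sub>R v"] by simp
      moreover have "\<tau> + 1 < norm z" using False by simp
      ultimately have "\<tau> < norm (t k *\<^sub>R v + z)" "\<tau> < norm z"
        using tv t[of k] by linarith+
      then show ?thesis using False by (simp add: Q_def g_def)
    qed
  qed
  have lim: "AE z in lborel. (\<lambda>k. Q k z) \<longlonglongrightarrow> indicator ?S z *\<^sub>R D z v"
  proof -
    \<comment> \<open>On the sphere the quotients may fail to converge to the integrand; it is a
      null set.\<close>
    have "sphere (0::'a) \<tau> \<in> null_sets lborel"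
      using negligible_sphere[of "0::'a" \<tau>]
      by (auto simp: null_sets_completion_iff negligible_iff_null_sets)
    from AE_not_in[OF this] show ?thesis
    proof eventually_elim
      fix z :: 'a
      assume z: "z \<notin> sphere 0 \<tau>"
      have tz: "(\<lambda>k. t k *\<^sub>R v + z) \<longlonglongrightarrow> 0 *\<^sub>R v + z" by (intro tendsto_intros t0)
      show "(\<lambda>k. Q k z) \<longlonglongrightarrow> indicator ?S z *\<^sub>R D z v"
      proof (cases "norm z < \<tau>")
        case True
        have "((\<lambda>s. G (s *\<^sub>R v + z)) has_derivative (\<lambda>s. D z (s *\<^sub>R v))) (at 0)"
          by (rule has_derivative_compose[of "\<lambda>s. s *\<^sub>R v + z" "\<lambda>s. s *\<^sub>R v" 0 UNIV G "D z"])
            (use True deriv[of z] in \<open>auto intro!: derivative_eq_intros\<close>)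
        moreover have "(\<lambda>s. D z (s *\<^sub>R v)) = (*) (D z v)"
          using linear_scale[OF lin, of z _ v] True by (simp add: fun_eq_iff mult.commute)
        ultimately have "((\<lambda>s. G (s *\<^sub>R v + z)) has_real_derivative D z v) (at 0)"
          by (simp add: has_field_derivative_def)
        then have "(\<lambda>h. (G (h *\<^sub>R v + z) - G z) / h) \<midarrow>0\<rightarrow> D z v"
          by (simp add: DERIV_def)
        then have "(\<lambda>k. (G (t k *\<^sub>R v + z) - G z) / t k) \<longlonglongrightarrow> D z v"
          by (rule filterlim_compose) (use t0 t in \<open>simp add: filterlim_at order_less_imp_not_eq2\<close>)
        moreover have "\<forall>\<^sub>F k in sequentially. t k *\<^sub>R v + z \<in> ball 0 \<tau>"
          using topological_tendstoD[OF tz, of "ball 0 \<tau>"] True by simp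
        then have "\<forall>\<^sub>F k in sequentially. (G (t k *\<^sub>R v + z) - G z) / t k = Q k z"
          by eventually_elim (use True in \<open>auto simp: Q_def g_def\<close>)
        ultimately show ?thesis using True by (simp add: tendsto_cong)
      next
        case False
        then have out: "z \<in> - ?S" using z by auto
        have "\<forall>\<^sub>F k in sequentially. t k *\<^sub>R v + z \<in> - ?S"
          using topological_tendstoD[OF tz, of "- ?S"] out by (simp add: open_Compl)
        then have "\<forall>\<^sub>F k in sequentially. Q k z = 0"
          by eventually_elim (use out in \<open>auto simp: Q_def g_def\<close>)
        then have "(\<lambda>k. Q k z) \<longlonglongrightarrow> 0" by (rule tendsto_eventually)
        then show ?thesis using out by simp
      qed
    qed
  qed
  show "integrable lborel (\<lambda>z. indicator ?S z *\<^sub>R D z v)"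
    by (rule integrable_dominated_convergence[OF fm Qm wint lim bound])
  have "(\<lambda>k. \<integral>z. Q k z \<partial>lborel) \<longlonglongrightarrow> (\<integral>z. indicator ?S z *\<^sub>R D z v \<partial>lborel)"
    by (rule integral_dominated_convergence[OF fm Qm wint lim bound])
  then show "(\<integral>z. indicator ?S z *\<^sub>R D z v \<partial>lborel) = 0"
    unfolding Q0 by (simp add: LIMSEQ_const_iff)
qed

section \<open>Mean value property of the Poisson kernel\<close>

context
  fixes a :: "'a::euclidean_space"
begin

text \<open>
  Up to normalisation \<open>poisson\<close> is the Poisson kernel of the ball of radius \<open>norm a\<close> with pole
  \<open>-a\<close>, hence harmonic; \<open>poisson_grad\<close> is its gradient.
\<close>

definition poisson :: "'a \<Rightarrow> real" where
  "poisson y = (a \<bullet> a - y \<bullet> y) * ((a + y) \<bullet> (a + y)) powr (- real DIM('a) / 2)"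

definition poisson_grad :: "'a \<Rightarrow> 'a" where
  "poisson_grad y =
     (- 2 * ((a + y) \<bullet> (a + y)) powr (- real DIM('a) / 2)) *\<^sub>R y
     - (real DIM('a) * (a \<bullet> a - y \<bullet> y) * ((a + y) \<bullet> (a + y)) powr (- real DIM('a) / 2 - 1)) *\<^sub>R (a + y)"

definition poisson_hess :: "'a \<Rightarrow> 'a \<Rightarrow> 'a" where
  "poisson_hess y v =
     (- 2 * ((a + y) \<bullet> (a + y)) powr (- real DIM('a) / 2)) *\<^sub>R v
     + (2 * real DIM('a) * ((a + y) \<bullet> (a + y)) powr (- real DIM('a) / 2 - 1) * ((a + y) \<bullet> v)) *\<^sub>R y
     + (2 * real DIM('a) * ((a + y) \<bullet> (a + y)) powr (- real DIM('a) / 2 - 1) * (y \<bullet> v)) *\<^sub>R (a + y)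
     + (real DIM('a) * (real DIM('a) + 2) * (a \<bullet> a - y \<bullet> y)
         * ((a + y) \<bullet> (a + y)) powr (- real DIM('a) / 2 - 2) * ((a + y) \<bullet> v)) *\<^sub>R (a + y)
     - (real DIM('a) * (a \<bullet> a - y \<bullet> y) * ((a + y) \<bullet> (a + y)) powr (- real DIM('a) / 2 - 1)) *\<^sub>R v"

lemma has_derivative_sq_powr:
  assumes "a + y \<noteq> 0"
  shows "((\<lambda>y. ((a + y) \<bullet> (a + y)) powr q) has_derivative
    (\<lambda>v. 2 * ((a + y) \<bullet> v) * (q * ((a + y) \<bullet> (a + y)) powr (q - 1)))) (at y)"
proof -
  have "((\<lambda>y. (a + y) \<bullet> (a + y)) has_derivative (\<lambda>v. 2 * ((a + y) \<bullet> v))) (at y)"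
    by (auto intro!: derivative_eq_intros simp: inner_commute)
  moreover have "((\<lambda>z. z powr q) has_real_derivative q * ((a + y) \<bullet> (a + y)) powr (q - 1))
      (at ((a + y) \<bullet> (a + y)))"
    by (rule has_real_derivative_powr) (use assms in simp)
  ultimately show ?thesis by (rule DERIV_compose_FDERIV[rotated])
qed

lemma has_derivative_poisson:
  assumes "a + y \<noteq> 0"
  shows "(poisson has_derivative (\<lambda>v. poisson_grad y \<bullet> v)) (at y)"
  unfolding poisson_def[abs_def]
  by (rule has_derivative_sq_powr[OF assms] derivative_eq_intros refl)+
    (simp add: fun_eq_iff poisson_grad_def inner_diff_left inner_commute algebra_simps add_divide_distrib diff_divide_distrib)

lemma has_derivative_poisson_grad:
  assumes "a + y \<noteq> 0"
  shows "(poisson_grad has_derivative poisson_hess y) (at y)"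
  unfolding poisson_grad_def[abs_def]
  by (rule has_derivative_sq_powr[OF assms] derivative_eq_intros refl)+
    (simp add: fun_eq_iff poisson_hess_def inner_commute algebra_simps add_divide_distrib diff_divide_distrib)

text \<open>Harmonicity of the kernel: with \<open>A = a + y\<close> all terms share the factor
  \<open>2 * d * P\<close>, and what is left is \<open>- (A \<bullet> A) + 2 * (A \<bullet> y) + a
  \<bullet> a - y \<bullet> y\<close>, which vanishes on expanding.\<close>

lemma trace_poisson_hess:
  assumes "a + y \<noteq> 0"
  shows "(\<Sum>i\<in>Basis. poisson_hess y i \<bullet> i) = 0"
proof -
  define d where "d = real DIM('a)"
  define A where "A = a + y"
  define N where "N = A \<bullet> A"
  define c where "c = a \<bullet> a - y \<bullet> y"
  define P where "P = N powr (- d / 2 - 1)"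
  define Q where "Q = N powr (- d / 2 - 2)"
  have N: "N > 0" using assms by (simp add: N_def A_def)
  have P0: "N powr (- d / 2) = N * P"
    using N powr_add[of N 1 "- d / 2 - 1"] by (simp add: P_def)
  have P2: "Q * N = P"
  proof -
    have "P = N powr ((- d / 2 - 2) + 1)" unfolding P_def by (rule arg_cong[where f = "(powr) N"]) simp
    also have "\<dots> = Q * N" using N unfolding Q_def by (subst powr_add) simp
    finally show ?thesis by simp
  qed
  have tr: "(\<Sum>i\<in>Basis. (u \<bullet> i) * (w \<bullet> i)) = u \<bullet> w" for u w :: 'a
    by (rule euclidean_inner[symmetric])
  have "(\<Sum>i\<in>Basis. poisson_hess y i \<bullet> i)
    = (\<Sum>i\<in>Basis. - 2 * (N * P) * (i \<bullet> i)
        + 2 * d * P * ((A \<bullet> i) * (y \<bullet> i)) + 2 * d * P * ((y \<bullet> i) * (A \<bullet> i))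
        + d * (d + 2) * c * Q * ((A \<bullet> i) * (A \<bullet> i)) - d * c * P * (i \<bullet> i))"
    unfolding poisson_hess_def A_def[symmetric] N_def[symmetric] c_def[symmetric] d_def[symmetric]
      P_def[symmetric] Q_def[symmetric] P0
    by (simp only: inner_add_left inner_diff_left inner_scaleR_left mult_ac)
  also have "\<dots> = - 2 * (N * P) * d + 2 * d * P * (A \<bullet> y) + 2 * d * P * (y \<bullet> A)
        + d * (d + 2) * c * Q * N - d * c * P * d"
    by (simp only: sum.distrib sum_subtractf sum_distrib_left[symmetric] tr N_def[symmetric])
      (simp add: d_def)
  also have "\<dots> = 2 * d * P * (- N + 2 * (A \<bullet> y) + c)"
    unfolding P2[symmetric] by (simp add: inner_commute algebra_simps)
  also have "- N + 2 * (A \<bullet> y) + c = 0"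
    by (simp add: N_def A_def c_def inner_add_left inner_add_right inner_commute)
  finally show ?thesis by simp
qed

lemma continuous_on_sq_powr:
  assumes "continuous_on T f" "\<And>x. x \<in> T \<Longrightarrow> a + f x \<noteq> 0"
  shows "continuous_on T (\<lambda>x. ((a + f x) \<bullet> (a + f x)) powr q)"
  by (rule continuous_on_powr') (use assms in \<open>auto intro!: continuous_intros simp del: inner_add_left inner_add_right\<close>)

lemma continuous_on_poisson_grad:
  assumes "continuous_on T f" "\<And>x. x \<in> T \<Longrightarrow> a + f x \<noteq> 0"
  shows "continuous_on T (\<lambda>x. poisson_grad (f x))"
  unfolding poisson_grad_def
  by (intro continuous_on_add continuous_on_diff continuous_on_scaleR continuous_on_mult
      continuous_on_inner continuous_on_const continuous_on_sq_powr[of T f] assms)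

lemma continuous_on_poisson_hess:
  assumes "continuous_on T f" "continuous_on T g" "\<And>x. x \<in> T \<Longrightarrow> a + f x \<noteq> 0"
  shows "continuous_on T (\<lambda>x. poisson_hess (f x) (g x))"
  unfolding poisson_hess_def
  by (intro continuous_on_add continuous_on_diff continuous_on_scaleR continuous_on_mult
      continuous_on_inner continuous_on_const continuous_on_sq_powr[of T f] assms)

text \<open>The integrand is minus the divergence of the field
  \<open>W z *\<^sub>R poisson_grad (s *\<^sub>R z)\<close>: the gradient of \<open>W\<close> is
  \<open>- z\<close> divided by \<open>a \<bullet> a - z \<bullet> z\<close>, the remaining term is
  a multiple of the Laplacian of a harmonic function, and \<open>W\<close> vanishes on the sphere of
  radius \<open>\<tau>\<close>.\<close>

lemma integral_cball_poisson_grad_eq_0: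
  assumes "0 < \<tau>" "\<tau> < norm a" "0 \<le> s" "s \<le> 1"
  shows "(\<integral>z. indicator (cball 0 \<tau>) z *\<^sub>R (z \<bullet> poisson_grad (s *\<^sub>R z) / (a \<bullet> a - z \<bullet> z)) \<partial>lborel) = 0"
proof -
  let ?S = "cball 0 \<tau> :: 'a set"
  define W where "W z = (ln (a \<bullet> a - z \<bullet> z) - ln (a \<bullet> a - \<tau>\<^sup>2)) / 2" for z :: 'a
  \<comment> \<open>The derivative at \<open>z\<close> in direction \<open>v\<close> of the
    coordinate \<open>i\<close> of that field.\<close>
  define D where "D i z v = - (z \<bullet> v) / (a \<bullet> a - z \<bullet> z) * (poisson_grad (s *\<^sub>R z) \<bullet> i)
    + W z * s * (poisson_hess (s *\<^sub>R z) v \<bullet> i)" for i z v :: 'a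
  have pos: "0 < a \<bullet> a - z \<bullet> z" and ne: "a + s *\<^sub>R z \<noteq> 0" if "norm z \<le> \<tau>" for z :: 'a
  proof -
    have "norm z < norm a" using that assms by simp
    then have "(norm z)\<^sup>2 < (norm a)\<^sup>2" by (rule power_strict_mono) auto
    then show "0 < a \<bullet> a - z \<bullet> z" by (simp add: power2_norm_eq_inner)
    have "norm (s *\<^sub>R z) \<le> norm z" using assms by (simp add: mult_left_le_one_le)
    then have "norm (- (s *\<^sub>R z)) < norm a" using \<open>norm z < norm a\<close> by simp
    then show "a + s *\<^sub>R z \<noteq> 0" by (metis less_irrefl add_eq_0_iff2)
  qed
  have deriv: "((\<lambda>z. W z * (poisson_grad (s *\<^sub>R z) \<bullet> i)) has_derivative D i z) (at z)"
    if "norm z \<le> \<tau>" for i z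
  proof -
    have 1: "(W has_derivative (\<lambda>v. - (z \<bullet> v) / (a \<bullet> a - z \<bullet> z))) (at z)"
      unfolding W_def[abs_def] using pos[OF that]
      by (auto intro!: derivative_eq_intros simp: inner_commute field_simps)
    have 2: "((\<lambda>z. poisson_grad (s *\<^sub>R z)) has_derivative (\<lambda>v. poisson_hess (s *\<^sub>R z) (s *\<^sub>R v))) (at z)"
      by (rule has_derivative_compose[of "\<lambda>z. s *\<^sub>R z" "\<lambda>v. s *\<^sub>R v" z UNIV poisson_grad "poisson_hess (s *\<^sub>R z)"])
        (use has_derivative_poisson_grad[OF ne[OF that]] in \<open>auto intro!: derivative_eq_intros\<close>)
    have 3: "poisson_hess (s *\<^sub>R z) (s *\<^sub>R v) = s *\<^sub>R poisson_hess (s *\<^sub>R z) v" for v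
      by (simp add: poisson_hess_def algebra_simps)
    show ?thesis
      by (rule derivative_eq_intros 1 2 refl)+
        (simp add: D_def 3 fun_eq_iff algebra_simps)
  qed
  have pos': "a \<bullet> a - z \<bullet> z \<noteq> 0" "0 < a \<bullet> a - z \<bullet> z" if "norm z \<le> \<tau>" for z :: 'a
    using pos[OF that] by auto
  have bdry: "W z * (poisson_grad (s *\<^sub>R z) \<bullet> i) = 0" if "norm z = \<tau>" for i z
  proof -
    have "z \<bullet> z = \<tau>\<^sup>2" unfolding power2_norm_eq_inner[symmetric] that ..
    then show ?thesis by (simp add: W_def)
  qed
  have cont: "continuous_on (?S \<times> cball 0 1) (\<lambda>(z, v). D i z v)" for i
  proof -
    have "continuous_on (?S \<times> cball 0 1) (\<lambda>p. W (fst p))"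
      unfolding W_def by (intro continuous_intros) (use pos' in force)+
    moreover have "continuous_on (?S \<times> cball 0 1) (\<lambda>p. - (fst p \<bullet> snd p) / (a \<bullet> a - fst p \<bullet> fst p))"
      by (intro continuous_intros) (use pos' in force)
    moreover have "continuous_on (?S \<times> cball 0 1) (\<lambda>p. poisson_grad (s *\<^sub>R fst p) \<bullet> i)"
      by (intro continuous_intros continuous_on_poisson_grad) (use ne in force)
    moreover have "continuous_on (?S \<times> cball 0 1) (\<lambda>p. poisson_hess (s *\<^sub>R fst p) (snd p) \<bullet> i)"
      by (intro continuous_intros continuous_on_poisson_hess) (use ne in force)
    ultimately show ?thesis
      unfolding D_def case_prod_unfold by (intro continuous_on_add continuous_on_mult continuous_on_const)
  qed
  note D = integral_cball_derivative_eq_0[OF assms(1) deriv cont bdry eq_refl[OF norm_Basis]]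
  have "(\<Sum>i\<in>Basis. D i z i) = - (z \<bullet> poisson_grad (s *\<^sub>R z) / (a \<bullet> a - z \<bullet> z))" if "norm z \<le> \<tau>" for z :: 'a
  proof -
    have "(\<Sum>i\<in>Basis. D i z i)
      = - 1 / (a \<bullet> a - z \<bullet> z) * (\<Sum>i\<in>Basis. (z \<bullet> i) * (poisson_grad (s *\<^sub>R z) \<bullet> i))
        + W z * s * (\<Sum>i\<in>Basis. poisson_hess (s *\<^sub>R z) i \<bullet> i)"
      by (simp add: D_def sum.distrib sum_distrib_left sum_negf sum_subtractf)
    then show ?thesis
      by (simp add: trace_poisson_hess[OF ne[OF that]] flip: euclidean_inner)
  qed
  then have "(\<integral>z. indicator ?S z *\<^sub>R (z \<bullet> poisson_grad (s *\<^sub>R z) / (a \<bullet> a - z \<bullet> z)) \<partial>lborel)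
      = (\<integral>z. - (\<Sum>i\<in>Basis. indicator ?S z *\<^sub>R D i z i) \<partial>lborel)"
    by (intro Bochner_Integration.integral_cong)
      (auto simp: sum_distrib_left[symmetric] split: split_indicator)
  also have "\<dots> = - (\<integral>z. (\<Sum>i\<in>Basis. indicator ?S z *\<^sub>R D i z i) \<partial>lborel)"
    by (rule Bochner_Integration.integral_minus)
  also have "(\<integral>z. (\<Sum>i\<in>Basis. indicator ?S z *\<^sub>R D i z i) \<partial>lborel)
      = (\<Sum>i\<in>Basis. \<integral>z. indicator ?S z *\<^sub>R D i z i \<partial>lborel)"
    by (rule Bochner_Integration.integral_sum) (rule D(1))
  also have "\<dots> = 0" by (rule sum.neutral) (intro ballI D(2))
  finally show ?thesis by simp
qed

text \<open>A mean value property with weight \<open>1 / (a \<bullet> a - z \<bullet> z)\<close>: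
  integrating the derivative of \<open>poisson (s *\<^sub>R z)\<close> over \<open>s\<close> from 0
  to 1 and exchanging the integrals shows that \<open>poisson z - poisson 0\<close> has weighted
  integral 0. The weight cancels the first factor of \<open>poisson z\<close> and leaves the power
  of the norm.\<close>

lemma integral_cball_shifted_norm_powr:
  assumes "0 < \<tau>" "\<tau> < norm a"
  shows "(\<integral>z. indicator (cball 0 \<tau>) z *\<^sub>R ((a + z) \<bullet> (a + z)) powr (- real DIM('a) / 2) \<partial>lborel)
    = poisson 0 * (\<integral>z. indicator (cball (0::'a) \<tau>) z *\<^sub>R (1 / (a \<bullet> a - z \<bullet> z)) \<partial>lborel)"
proof -
  let ?S = "cball 0 \<tau> :: 'a set"
  let ?w = "\<lambda>z::'a. a \<bullet> a - z \<bullet> z"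
  define K where "K = (\<lambda>(z, s). z \<bullet> poisson_grad (s *\<^sub>R z) / ?w z)"
  define f where "f z s = indicator (?S \<times> {0..1::real}) (z, s) *\<^sub>R K (z, s)" for z s
  have pos: "0 < ?w z" if "norm z \<le> \<tau>" for z :: 'a
  proof -
    have "(norm z)\<^sup>2 < (norm a)\<^sup>2" by (rule power_strict_mono) (use that assms in auto)
    then show ?thesis by (simp add: power2_norm_eq_inner)
  qed
  have ne: "a + s *\<^sub>R z \<noteq> 0" if "norm z \<le> \<tau>" "0 \<le> s" "s \<le> 1" for z :: 'a and s
  proof -
    have "norm (s *\<^sub>R z) \<le> norm z" using that by (simp add: mult_left_le_one_le)
    then have "norm (- (s *\<^sub>R z)) < norm a" using that assms by simp
    then show ?thesis by (metis less_irrefl add_eq_0_iff2)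
  qed
  have pos': "?w z \<noteq> 0" if "norm z \<le> \<tau>" for z :: 'a using pos[OF that] by simp
  have cont: "continuous_on (?S \<times> {0..1}) K"
    unfolding K_def case_prod_unfold
    by (intro continuous_intros continuous_on_poisson_grad) (use pos' ne in force)+
  have "integrable (lborel \<Otimes>\<^sub>M lborel) (\<lambda>(z, s). f z s)"
    unfolding lborel_prod f_def case_prod_unfold prod.collapse
    by (rule borel_integrable_compact[OF _ cont]) (auto intro: compact_Times)
  then have "(\<integral>z. (\<integral>s. f z s \<partial>lborel) \<partial>lborel) = (\<integral>s. (\<integral>z. f z s \<partial>lborel) \<partial>lborel)"
    by (rule lborel_pair.Fubini_integral[symmetric])
  also have "(\<lambda>s. \<integral>z. f z s \<partial>lborel) = (\<lambda>_. 0)"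
  proof
    fix s
    have "(\<integral>z. f z s \<partial>lborel)
      = indicator {0..1} s * (\<integral>z. indicator ?S z *\<^sub>R K (z, s) \<partial>lborel)"
      by (simp add: f_def indicator_times split: split_indicator)
    also have "\<dots> = 0"
      using integral_cball_poisson_grad_eq_0[OF assms, of s] by (simp add: K_def split: split_indicator)
    finally show "(\<integral>z. f z s \<partial>lborel) = 0" .
  qed
  also have "(\<lambda>z. \<integral>s. f z s \<partial>lborel) = (\<lambda>z. indicator ?S z *\<^sub>R ((poisson z - poisson 0) / ?w z))"
  proof
    fix z
    show "(\<integral>s. f z s \<partial>lborel) = indicator ?S z *\<^sub>R ((poisson z - poisson 0) / ?w z)"
    proof (cases "z \<in> ?S")
      case False
      then show ?thesis by (simp add: f_def indicator_times)
    next
      case True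
      have z: "norm z \<le> \<tau>" using True by simp
      have "((\<lambda>s. poisson (s *\<^sub>R z) / ?w z) has_vector_derivative K (z, s)) (at s within {0..1})"
        if "0 \<le> s" "s \<le> 1" for s
      proof -
        have "((\<lambda>s. poisson (s *\<^sub>R z)) has_derivative (\<lambda>h. poisson_grad (s *\<^sub>R z) \<bullet> (h *\<^sub>R z))) (at s within {0..1})"
          by (rule has_derivative_compose[of "\<lambda>s. s *\<^sub>R z" "\<lambda>h. h *\<^sub>R z" s "{0..1}" poisson "\<lambda>v. poisson_grad (s *\<^sub>R z) \<bullet> v"])
            (use has_derivative_poisson[OF ne[OF z that]] in \<open>auto intro!: derivative_eq_intros\<close>)
        then show ?thesis
          unfolding has_vector_derivative_def K_def
          using pos'[OF z] by (auto intro!: derivative_eq_intros simp: inner_commute)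
      qed
      moreover have "continuous_on {0..1} (\<lambda>s. K (z, s))"
        by (rule continuous_on_compose2[OF cont]) (use z in \<open>auto intro!: continuous_intros\<close>)
      ultimately have "(\<integral>s. indicator {0..1} s *\<^sub>R K (z, s) \<partial>lborel)
          = poisson (1 *\<^sub>R z) / ?w z - poisson (0 *\<^sub>R z) / ?w z"
        by (intro integral_FTC_Icc) auto
      then show ?thesis using True by (simp add: f_def indicator_times diff_divide_distrib)
    qed
  qed
  finally have "(\<integral>z. indicator ?S z *\<^sub>R ((poisson z - poisson 0) / ?w z) \<partial>lborel) = 0" by simp
  also have "(\<lambda>z. indicator ?S z *\<^sub>R ((poisson z - poisson 0) / ?w z))
      = (\<lambda>z. indicator ?S z *\<^sub>R ((a + z) \<bullet> (a + z)) powr (- real DIM('a) / 2)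
           - poisson 0 * (indicator ?S z *\<^sub>R (1 / ?w z)))"
  proof
    fix z
    have "poisson z / ?w z = ((a + z) \<bullet> (a + z)) powr (- real DIM('a) / 2)" if "norm z \<le> \<tau>"
      using pos[OF that] by (simp add: poisson_def)
    then show "indicator ?S z *\<^sub>R ((poisson z - poisson 0) / ?w z)
      = indicator ?S z *\<^sub>R ((a + z) \<bullet> (a + z)) powr (- real DIM('a) / 2)
           - poisson 0 * (indicator ?S z *\<^sub>R (1 / ?w z))"
      by (simp add: diff_divide_distrib split: split_indicator)
  qed
  also have "(\<integral>z. indicator ?S z *\<^sub>R ((a + z) \<bullet> (a + z)) powr (- real DIM('a) / 2)
           - poisson 0 * (indicator ?S z *\<^sub>R (1 / ?w z)) \<partial>lborel)
    = (\<integral>z. indicator ?S z *\<^sub>R ((a + z) \<bullet> (a + z)) powr (- real DIM('a) / 2) \<partial>lborel)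
      - poisson 0 * (\<integral>z. indicator ?S z *\<^sub>R (1 / ?w z) \<partial>lborel)"
  proof (subst Bochner_Integration.integral_diff)
    have "continuous_on ?S (\<lambda>z. ((a + z) \<bullet> (a + z)) powr (- real DIM('a) / 2))"
      by (intro continuous_on_sq_powr continuous_intros) (use ne[of _ 1] in force)
    then show "integrable lborel (\<lambda>z. indicator ?S z *\<^sub>R ((a + z) \<bullet> (a + z)) powr (- real DIM('a) / 2))"
      by (intro borel_integrable_compact) auto
    have "continuous_on ?S (\<lambda>z. 1 / ?w z)"
      using pos' by (intro continuous_intros) auto
    then show "integrable lborel (\<lambda>z. poisson 0 * (indicator ?S z *\<^sub>R (1 / ?w z)))"
      by (intro integrable_mult_right borel_integrable_compact) auto
  qed (simp only: integral_mult_right_zero)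
  finally show ?thesis by (simp only: right_minus_eq)
qed

end

section \<open>Logarithmic volume\<close>

definition growth :: "nat \<Rightarrow> real \<Rightarrow> real" where
  "growth d t = integral {0..t} (\<lambda>u. u ^ (d - 1) / (1 - u\<^sup>2))"

lemma kappa_eq_exp_growth: "kappa d = exp (growth d (1 / 2))"
  by (simp add: kappa_def growth_def)

lemma growth_0 [simp]: "growth d 0 = 0"
  by (simp add: growth_def)

lemma continuous_on_growth_integrand:
  assumes "b < 1"
  shows "continuous_on {0..b} (\<lambda>u::real. u ^ (d - 1) / (1 - u\<^sup>2))"
proof -
  have "1 - u\<^sup>2 \<noteq> 0" if "u \<in> {0..b}" for u
    using that assms power_strict_mono[of u 1 2] by auto
  then show ?thesis by (intro continuous_intros) auto
qed

lemma growth_has_real_derivative: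
  assumes "t \<in> {0..b}" "b < 1"
  shows "(growth d has_real_derivative t ^ (d - 1) / (1 - t\<^sup>2)) (at t within {0..b})"
  unfolding growth_def[abs_def]
  by (rule integral_has_real_derivative) (use assms continuous_on_growth_integrand in auto)

lemma growth_mono:
  assumes "0 \<le> s" "s \<le> t" "t < 1"
  shows "growth d s \<le> growth d t"
proof (rule DERIV_nonneg_imp_increasing_open[of s t "growth d"])
  fix x assume x: "s < x" "x < t"
  have "(growth d has_real_derivative x ^ (d - 1) / (1 - x\<^sup>2)) (at x within {0..t})"
    by (rule growth_has_real_derivative) (use x assms in auto)
  then have "(growth d has_real_derivative x ^ (d - 1) / (1 - x\<^sup>2)) (at x)"
    using x assms by (simp add: at_within_Icc_at)
  moreover have "0 \<le> x ^ (d - 1) / (1 - x\<^sup>2)"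
    using x assms power_mono[of x 1 2] by auto
  ultimately show "\<exists>y. (growth d has_real_derivative y) (at x) \<and> 0 \<le> y" by blast
next
  have "continuous_on {0..t} (growth d)"
    using assms growth_has_real_derivative[of _ t d] by (intro DERIV_continuous_on) auto
  then show "continuous_on {s..t} (growth d)" by (rule continuous_on_subset) (use assms in auto)
qed (use assms in auto)

lemma inner_self_powr:
  fixes v :: "'a::real_inner"
  assumes "v \<noteq> 0"
  shows "(v \<bullet> v) powr (- real d / 2) = 1 / norm v ^ d"
proof -
  have v: "v \<bullet> v = norm v powr 2" using assms by (simp add: power2_norm_eq_inner)
  have "(v \<bullet> v) powr (- real d / 2) = norm v powr (- real d)" unfolding v powr_powr by simp
  moreover have "0 < norm v" using assms by simp
  ultimately show ?thesis by (simp only: powr_minus powr_realpow inverse_eq_divide)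
qed

text \<open>In polar coordinates the substitution \<open>r = \<rho> * u\<close> leads to the
  integral that defines \<open>growth\<close>; it is carried out by differentiating the
  antiderivative \<open>F\<close>.\<close>

lemma nn_integral_cball_inverse_defect:
  fixes \<rho> s :: real
  assumes "0 < s" "s < \<rho>"
  shows "(\<integral>\<^sup>+z. ennreal (indicator (cball (0::'a::euclidean_space) s) z *\<^sub>R (1 / (\<rho>\<^sup>2 - z \<bullet> z))) \<partial>lborel)
    = ennreal (DIM('a) * unit_ball_vol DIM('a) * \<rho> ^ DIM('a) / \<rho>\<^sup>2 * growth DIM('a) (s / \<rho>))"
proof -
  let ?d = "DIM('a)" and ?v = "unit_ball_vol DIM('a)"
  have \<rho>: "\<rho> > 0" "s / \<rho> < 1" using assms by auto
  have [measurable]: "(\<lambda>r. ennreal (indicator {0..s} r * (1 / (\<rho>\<^sup>2 - r\<^sup>2)))) \<in> borel_measurable borel"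
    by measurable
  have "(\<integral>\<^sup>+z. ennreal (indicator (cball (0::'a) s) z *\<^sub>R (1 / (\<rho>\<^sup>2 - z \<bullet> z))) \<partial>lborel)
      = (\<integral>\<^sup>+z. ennreal (indicator {0..s} (norm (z::'a)) * (1 / (\<rho>\<^sup>2 - (norm z)\<^sup>2))) \<partial>lborel)"
    by (intro nn_integral_cong) (auto simp: power2_norm_eq_inner split: split_indicator)
  also have "\<dots> = (\<integral>\<^sup>+r. ennreal (?d * ?v * r ^ (?d - 1)) * indicator {0..} r
      * ennreal (indicator {0..s} r * (1 / (\<rho>\<^sup>2 - r\<^sup>2))) \<partial>lborel)"
    by (rule nn_integral_radial) measurable
  also have "\<dots> = (\<integral>\<^sup>+r. ennreal (indicator {0..s} r *\<^sub>R (?d * ?v * (r ^ (?d - 1) / (\<rho>\<^sup>2 - r\<^sup>2)))) \<partial>lborel)"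
  proof (intro nn_integral_cong)
    fix r :: real
    show "ennreal (?d * ?v * r ^ (?d - 1)) * indicator {0..} r * ennreal (indicator {0..s} r * (1 / (\<rho>\<^sup>2 - r\<^sup>2)))
      = ennreal (indicator {0..s} r *\<^sub>R (?d * ?v * (r ^ (?d - 1) / (\<rho>\<^sup>2 - r\<^sup>2))))"
      using assms by (cases "r \<in> {0..s}") (simp_all flip: ennreal_mult')
  qed
  also have "\<dots> = ennreal (?d * ?v * \<rho> ^ ?d / \<rho>\<^sup>2 * growth ?d (s / \<rho>))"
  proof -
    define F where "F r = ?d * ?v * \<rho> ^ ?d / \<rho>\<^sup>2 * growth ?d (r / \<rho>)" for r
    let ?f = "\<lambda>r. ?d * ?v * (r ^ (?d - 1) / (\<rho>\<^sup>2 - r\<^sup>2))"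
    have pos: "0 < \<rho>\<^sup>2 - r\<^sup>2" if "0 \<le> r" "r \<le> s" for r
      using power_strict_mono[of r \<rho> 2] that assms by simp
    have "(F has_vector_derivative ?f r) (at r within {0..s})" if r: "0 \<le> r" "r \<le> s" for r
    proof -
      have "(growth ?d has_real_derivative (r / \<rho>) ^ (?d - 1) / (1 - (r / \<rho>)\<^sup>2))
          (at (r / \<rho>) within {0..s / \<rho>})"
        by (rule growth_has_real_derivative) (use r \<rho> in \<open>auto intro: divide_right_mono\<close>)
      then have "(growth ?d has_real_derivative (r / \<rho>) ^ (?d - 1) / (1 - (r / \<rho>)\<^sup>2))
          (at (r / \<rho>) within (\<lambda>r. r / \<rho>) ` {0..s})"
        by (rule DERIV_subset) (use \<rho> in \<open>auto intro: divide_right_mono\<close>)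
      moreover have "((\<lambda>r. r / \<rho>) has_real_derivative 1 / \<rho>) (at r within {0..s})"
        by (rule DERIV_cdivide[OF DERIV_ident])
      ultimately have "(growth ?d \<circ> (\<lambda>r. r / \<rho>) has_real_derivative
          (r / \<rho>) ^ (?d - 1) / (1 - (r / \<rho>)\<^sup>2) * (1 / \<rho>)) (at r within {0..s})"
        by (rule DERIV_image_chain)
      then have "(F has_real_derivative
          ?d * ?v * \<rho> ^ ?d / \<rho>\<^sup>2 * ((r / \<rho>) ^ (?d - 1) / (1 - (r / \<rho>)\<^sup>2) * (1 / \<rho>))) (at r within {0..s})"
        unfolding F_def[abs_def] o_def by (rule DERIV_cmult)
      also have "?d * ?v * \<rho> ^ ?d / \<rho>\<^sup>2 * ((r / \<rho>) ^ (?d - 1) / (1 - (r / \<rho>)\<^sup>2) * (1 / \<rho>)) = ?f r"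
      proof -
        have 1: "1 - (r / \<rho>)\<^sup>2 = (\<rho>\<^sup>2 - r\<^sup>2) / \<rho>\<^sup>2"
          using \<rho> by (simp add: power_divide diff_divide_distrib)
        have 2: "\<rho> ^ ?d = \<rho> * \<rho> ^ (?d - 1)"
          by (metis DIM_positive power_minus_mult mult.commute)
        show ?thesis unfolding 1 unfolding 2 power_divide using \<rho> by simp
      qed
      finally show ?thesis by (simp only: has_real_derivative_iff_has_vector_derivative)
    qed
    moreover have cont: "continuous_on {0..s} ?f"
      using pos by (intro continuous_intros) force
    ultimately have "(\<integral>r. indicator {0..s} r *\<^sub>R ?f r \<partial>lborel) = F s - F 0"
      using assms by (intro integral_FTC_Icc) auto
    moreover have "(\<integral>\<^sup>+r. ennreal (indicator {0..s} r *\<^sub>R ?f r) \<partial>lborel)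
        = ennreal (\<integral>r. indicator {0..s} r *\<^sub>R ?f r \<partial>lborel)"
    proof (rule nn_integral_eq_integral)
      show "integrable lborel (\<lambda>r. indicator {0..s} r *\<^sub>R ?f r)"
        by (rule borel_integrable_compact[OF _ cont]) simp
      show "AE r in lborel. 0 \<le> indicator {0..s} r *\<^sub>R ?f r"
        using pos by (intro AE_I2) (auto simp: less_imp_le split: split_indicator)
    qed
    ultimately show ?thesis by (simp add: F_def)
  qed
  finally show ?thesis .
qed

section \<open>The dilation-invariant measure: balls, annuli and packing\<close>

definition log_volume :: "'a::euclidean_space measure" where
  "log_volume = density lborel (\<lambda>y. ennreal (1 / norm y ^ DIM('a)))"

lemma sets_log_volume [simp]: "sets log_volume = sets borel"
  by (simp add: log_volume_def)

text \<open>After translation to the origin the density is \<open>norm (x + z)\<close> to the power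
  \<open>- DIM('a)\<close>, so the mean value identity applies with \<open>a = x\<close>. The value
  \<open>poisson x 0\<close> cancels the powers of \<open>norm x\<close> in the weighted integral,
  and only the ratio \<open>s / norm x\<close> survives.\<close>

lemma emeasure_log_volume_cball:
  fixes x :: "'a::euclidean_space"
  assumes "0 < s" "s < norm x"
  shows "emeasure log_volume (cball x s)
    = ennreal (DIM('a) * unit_ball_vol DIM('a) * growth DIM('a) (s / norm x))"
proof -
  let ?d = "DIM('a)" and ?v = "unit_ball_vol DIM('a)"
  let ?g = "\<lambda>z. indicator (cball (0::'a) s) z *\<^sub>R ((x + z) \<bullet> (x + z)) powr (- real ?d / 2)"
  let ?h = "\<lambda>z. indicator (cball (0::'a) s) z *\<^sub>R (1 / (x \<bullet> x - z \<bullet> z))"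
  have ne: "x + z \<noteq> 0" and pos: "0 < x \<bullet> x - z \<bullet> z" if "norm z \<le> s" for z
  proof -
    have lt: "norm z < norm x" using that assms by simp
    then show "x + z \<noteq> 0" by (metis add_eq_0_iff2 less_irrefl norm_minus_cancel)
    show "0 < x \<bullet> x - z \<bullet> z"
      using power_strict_mono[OF lt, of 2] by (simp add: power2_norm_eq_inner)
  qed
  have [measurable]: "cball x s \<in> sets borel" by simp
  have "emeasure log_volume (cball x s) = (\<integral>\<^sup>+y. ennreal (1 / norm y ^ ?d) * indicator (cball x s) y \<partial>lborel)"
    unfolding log_volume_def by (rule emeasure_density) auto
  also have "\<dots> = (\<integral>\<^sup>+y. ennreal (1 / norm y ^ ?d) * indicator (cball x s) y \<partial>distr lborel borel ((+) x))"
    by (simp add: lborel_distr_plus)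
  also have "\<dots> = (\<integral>\<^sup>+z. ennreal (1 / norm (x + z) ^ ?d) * indicator (cball x s) (x + z) \<partial>lborel)"
    by (rule nn_integral_distr) measurable
  also have "\<dots> = (\<integral>\<^sup>+z. ennreal (?g z) \<partial>lborel)"
  proof (intro nn_integral_cong)
    fix z
    show "ennreal (1 / norm (x + z) ^ ?d) * indicator (cball x s) (x + z) = ennreal (?g z)"
    proof (cases "norm z \<le> s")
      case True
      then show ?thesis using inner_self_powr[OF ne[OF True], of ?d] by (simp add: dist_norm)
    qed (simp add: dist_norm)
  qed
  also have "\<dots> = ennreal (\<integral>z. ?g z \<partial>lborel)"
  proof (rule nn_integral_eq_integral)
    show "integrable lborel ?g"
      by (intro borel_integrable_compact continuous_on_sq_powr) (use ne in \<open>auto intro: continuous_on_id\<close>)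
  qed (auto split: split_indicator)
  also have "(\<integral>z. ?g z \<partial>lborel) = poisson x 0 * (\<integral>z. ?h z \<partial>lborel)"
    by (rule integral_cball_shifted_norm_powr[OF assms])
  also have "ennreal (poisson x 0 * (\<integral>z. ?h z \<partial>lborel)) = ennreal (poisson x 0) * (\<integral>\<^sup>+z. ennreal (?h z) \<partial>lborel)"
  proof -
    have "(\<integral>\<^sup>+z. ennreal (?h z) \<partial>lborel) = ennreal (\<integral>z. ?h z \<partial>lborel)"
    proof (rule nn_integral_eq_integral)
      have "continuous_on (cball (0::'a) s) (\<lambda>z. 1 / (x \<bullet> x - z \<bullet> z))"
        using pos by (intro continuous_intros) force
      then show "integrable lborel ?h" by (intro borel_integrable_compact) auto
    qed (use pos in \<open>auto simp: less_imp_le split: split_indicator\<close>)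
    then show ?thesis by (simp add: ennreal_mult' poisson_def)
  qed
  also have "(\<integral>\<^sup>+z. ennreal (?h z) \<partial>lborel)
      = ennreal (?d * ?v * norm x ^ ?d / (norm x)\<^sup>2 * growth ?d (s / norm x))"
    using nn_integral_cball_inverse_defect[OF assms, where 'a = 'a] by (simp only: power2_norm_eq_inner)
  also have "ennreal (poisson x 0) * \<dots> = ennreal (?d * ?v * growth ?d (s / norm x))"
  proof -
    have x: "x \<noteq> 0" using assms by auto
    have p: "poisson x 0 = (norm x)\<^sup>2 / norm x ^ ?d"
      using inner_self_powr[OF x, of ?d] by (simp add: poisson_def power2_norm_eq_inner)
    show ?thesis unfolding p using x by (simp add: ennreal_mult'[symmetric] mult.assoc)
  qed
  finally show ?thesis .
qed

text \<open>In polar coordinates the density reduces the surface factor to a multiple of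
  \<open>1 / r\<close>, hence the logarithm.\<close>

lemma emeasure_log_volume_annulus:
  assumes "0 < A" "A \<le> B"
  shows "emeasure log_volume {y::'a::euclidean_space. A \<le> norm y \<and> norm y \<le> B}
    = ennreal (DIM('a) * unit_ball_vol DIM('a) * ln (B / A))"
proof -
  let ?d = "DIM('a)" and ?v = "unit_ball_vol DIM('a)"
  have [measurable]: "{y::'a. A \<le> norm y \<and> norm y \<le> B} \<in> sets borel" by measurable
  have "emeasure log_volume {y::'a. A \<le> norm y \<and> norm y \<le> B}
      = (\<integral>\<^sup>+y. ennreal (1 / norm y ^ ?d) * indicator {y::'a. A \<le> norm y \<and> norm y \<le> B} y \<partial>lborel)"
    unfolding log_volume_def by (rule emeasure_density) auto
  also have "\<dots> = (\<integral>\<^sup>+y. ennreal (1 / norm (y::'a) ^ ?d) * indicator {A..B} (norm y) \<partial>lborel)"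
    by (intro nn_integral_cong) (auto split: split_indicator)
  also have "\<dots> = (\<integral>\<^sup>+r. ennreal (?d * ?v * r ^ (?d - 1)) * indicator {0..} r
      * (ennreal (1 / r ^ ?d) * indicator {A..B} r) \<partial>lborel)"
    by (rule nn_integral_radial) measurable
  also have "\<dots> = (\<integral>\<^sup>+r. ennreal (?d * ?v / r) * indicator {A..B} r \<partial>lborel)"
  proof (intro nn_integral_cong)
    fix r :: real
    have "ennreal (?d * ?v * r ^ (?d - 1)) * ennreal (1 / r ^ ?d) = ennreal (?d * ?v / r)" if "0 < r"
    proof -
      have "r ^ ?d = r * r ^ (?d - 1)" by (metis DIM_positive power_minus_mult mult.commute)
      then show ?thesis using that by (simp flip: ennreal_mult')
    qed
    then show "ennreal (?d * ?v * r ^ (?d - 1)) * indicator {0..} r * (ennreal (1 / r ^ ?d) * indicator {A..B} r)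
      = ennreal (?d * ?v / r) * indicator {A..B} r"
      using assms by (auto split: split_indicator)
  qed
  also have "\<dots> = ennreal (?d * ?v * ln B - ?d * ?v * ln A)"
  proof (rule nn_integral_FTC_Icc)
    show "((\<lambda>r. ?d * ?v * ln r) has_real_derivative ?d * ?v / r) (at r)" if "r \<in> {A..B}" for r
      using DERIV_cmult[OF DERIV_ln_divide[of r], of "?d * ?v"] that assms by simp
  qed (use assms in auto)
  also have "?d * ?v * ln B - ?d * ?v * ln A = ?d * ?v * ln (B / A)"
    using assms by (simp add: ln_div right_diff_distrib)
  finally show ?thesis .
qed

text \<open>The balls are disjoint and lie in the annulus, so their logarithmic volumes add up to at
  most that of the annulus; the common factor \<open>DIM('a) * unit_ball_vol DIM('a)\<close>
  cancels.\<close>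

lemma sum_growth_le_ln:
  fixes x :: "'i \<Rightarrow> 'a::euclidean_space"
  assumes "finite J" "0 < A" "A \<le> B"
    and s: "\<And>j. j \<in> J \<Longrightarrow> 0 < s j" "\<And>j. j \<in> J \<Longrightarrow> A + s j \<le> norm (x j)" "\<And>j. j \<in> J \<Longrightarrow> norm (x j) + s j \<le> B"
    and sep: "\<And>i j. i \<in> J \<Longrightarrow> j \<in> J \<Longrightarrow> i \<noteq> j \<Longrightarrow> s i + s j < dist (x i) (x j)"
  shows "(\<Sum>j\<in>J. growth DIM('a) (s j / norm (x j))) \<le> ln (B / A)"
proof -
  let ?C = "DIM('a) * unit_ball_vol DIM('a)"
  let ?g = "\<lambda>j. growth DIM('a) (s j / norm (x j))"
  have sx: "s j < norm (x j)" if "j \<in> J" for j using s(2)[OF that] assms by simp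
  have g: "0 \<le> ?g j" if "j \<in> J" for j
  proof -
    have "0 < norm (x j)" using s(1)[OF that] sx[OF that] by linarith
    then have "s j / norm (x j) < 1" using sx[OF that] by simp
    then show ?thesis using growth_mono[of 0 "s j / norm (x j)" "DIM('a)"] s(1)[OF that] by simp
  qed
  have "(\<Sum>j\<in>J. ennreal (?C * ?g j)) = (\<Sum>j\<in>J. emeasure log_volume (cball (x j) (s j)))"
    using s(1) sx by (intro sum.cong) (auto simp: emeasure_log_volume_cball)
  also have "\<dots> = emeasure log_volume (\<Union>j\<in>J. cball (x j) (s j))"
  proof (rule sum_emeasure)
    have "cball (x i) (s i) \<inter> cball (x j) (s j) = {}" if "i \<in> J" "j \<in> J" "i \<noteq> j" for i j
    proof -
      have False if "dist (x i) y \<le> s i" "dist (x j) y \<le> s j" for y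
        using dist_triangle2[of "x i" "x j" y] that sep[OF \<open>i \<in> J\<close> \<open>j \<in> J\<close> \<open>i \<noteq> j\<close>] by linarith
      then show ?thesis by auto
    qed
    then show "disjoint_family_on (\<lambda>j. cball (x j) (s j)) J" by (auto simp: disjoint_family_on_def)
  qed (use assms in auto)
  also have "\<dots> \<le> emeasure log_volume {y::'a. A \<le> norm y \<and> norm y \<le> B}"
  proof (rule emeasure_mono)
    show "(\<Union>j\<in>J. cball (x j) (s j)) \<subseteq> {y. A \<le> norm y \<and> norm y \<le> B}"
    proof (intro UN_least subsetI CollectI conjI)
      fix j y assume j: "j \<in> J" and "y \<in> cball (x j) (s j)"
      then have y: "norm (x j - y) \<le> s j" by (simp add: dist_norm)
      show "A \<le> norm y" using s(2)[OF j] y norm_triangle_ineq2[of "x j" y] by linarith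
      show "norm y \<le> B" using s(3)[OF j] y norm_triangle_ineq2[of y "x j"]
        by (simp add: norm_minus_commute)
    qed
  qed simp
  also have "\<dots> = ennreal (?C * ln (B / A))"
    by (rule emeasure_log_volume_annulus) fact+
  finally have "ennreal (\<Sum>j\<in>J. ?C * ?g j) \<le> ennreal (?C * ln (B / A))"
    using g by (subst sum_ennreal[symmetric]) auto
  then have "?C * (\<Sum>j\<in>J. ?g j) \<le> ?C * ln (B / A)"
    using assms by (simp add: sum_distrib_left)
  moreover have "?C > 0" by simp
  ultimately show ?thesis by simp
qed

section \<open>Packing and the game value\<close>

lemma growth_pos:
  assumes "0 < t" "t < 1"
  shows "0 < growth d t"
proof -
  have "growth d 0 < growth d t"
  proof (rule DERIV_pos_imp_increasing_open[of 0 t "growth d"])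
    fix x assume x: "0 < x" "x < t"
    have "(growth d has_real_derivative x ^ (d - 1) / (1 - x\<^sup>2)) (at x within {0..t})"
      by (rule growth_has_real_derivative) (use x assms in auto)
    then have "(growth d has_real_derivative x ^ (d - 1) / (1 - x\<^sup>2)) (at x)"
      using x by (simp add: at_within_Icc_at)
    moreover have "0 < x ^ (d - 1) / (1 - x\<^sup>2)"
      using x assms power_strict_mono[of x 1 2] by auto
    ultimately show "\<exists>y. (growth d has_real_derivative y) (at x) \<and> 0 < y" by blast
  next
    show "continuous_on {0..t} (growth d)"
      using assms growth_has_real_derivative[of _ t d] by (intro DERIV_continuous_on) auto
  qed (use assms in auto)
  then show ?thesis by simp
qed

text \<open>The factor \<open>ln L / growth d (1 / 2)\<close>, called \<open>\<theta>\<close>, gives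
  equality at \<open>g = L\<close>. For \<open>t = g / (2 * L)\<close> the claim compares
  \<open>\<theta> * growth d u - ln u\<close> at \<open>u = t\<close> and \<open>u = 1 / 2\<close>;
  this function decreases because \<open>\<theta> \<le> 1\<close>, the derivative of
  \<open>growth d\<close> is at most 2 and \<open>1 / u\<close> is at least 2.\<close>

lemma ln_le_scaled_growth:
  assumes L: "1 < L" "ln L \<le> growth d (1 / 2)" and g: "1 \<le> g" "g \<le> L"
  shows "ln g \<le> ln L / growth d (1 / 2) * growth d (g / (2 * L))"
proof -
  define \<theta> where "\<theta> = ln L / growth d (1 / 2)"
  have G: "0 < growth d (1 / 2)" by (rule growth_pos) auto
  have \<theta>: "0 \<le> \<theta>" "\<theta> \<le> 1" using L G by (auto simp: \<theta>_def divide_le_eq)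
  define t where "t = g / (2 * L)"
  have t: "0 < t" "t \<le> 1 / 2" using L g by (auto simp: t_def field_simps)
  define f where "f u = \<theta> * growth d u - ln u" for u
  have cont: "continuous_on {0..1 / 2} (growth d)"
    using growth_has_real_derivative[of _ "1 / 2" d] by (intro DERIV_continuous_on) auto
  have "f (1 / 2) \<le> f t"
  proof (rule DERIV_nonpos_imp_decreasing_open[of t "1 / 2" f])
    show "continuous_on {t..1 / 2} f" unfolding f_def[abs_def]
      using t by (intro continuous_intros continuous_on_subset[OF cont]) auto
    fix u assume u: "t < u" "u < 1 / 2"
    then have u0: "0 < u" "u < 1 / 2" using t by auto
    have "(growth d has_real_derivative u ^ (d - 1) / (1 - u\<^sup>2)) (at u within {0..1 / 2})"
      by (rule growth_has_real_derivative) (use u0 in auto)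
    then have "(growth d has_real_derivative u ^ (d - 1) / (1 - u\<^sup>2)) (at u)"
      using u0 by (simp add: at_within_Icc_at)
    then have "(f has_real_derivative \<theta> * (u ^ (d - 1) / (1 - u\<^sup>2)) - 1 / u) (at u)"
      unfolding f_def[abs_def] by (intro DERIV_diff DERIV_cmult DERIV_ln_divide u0)
    moreover have "\<theta> * (u ^ (d - 1) / (1 - u\<^sup>2)) \<le> 1 / u"
    proof -
      have "u * u \<le> 1 / 2 * (1 / 2)" using u0 by (intro mult_mono) auto
      then have sq: "1 / 2 \<le> 1 - u\<^sup>2" by (simp add: power2_eq_square)
      have "u ^ (d - 1) / (1 - u\<^sup>2) \<le> 1 / (1 / 2)"
        using sq u0 by (intro frac_le power_le_one) auto
      moreover have "0 \<le> u ^ (d - 1) / (1 - u\<^sup>2)" using sq u0 by simp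
      ultimately have "\<theta> * (u ^ (d - 1) / (1 - u\<^sup>2)) \<le> 1 * 2"
        using \<theta> by (intro mult_mono) auto
      also have "\<dots> \<le> 1 / u" using u0 by (simp add: field_simps)
      finally show ?thesis .
    qed
    ultimately show "\<exists>y. (f has_real_derivative y) (at u) \<and> y \<le> 0" by force
  qed (use t in auto)
  moreover have "\<theta> * growth d (1 / 2) = ln L" using G by (simp add: \<theta>_def)
  moreover have "ln t = ln g - ln 2 - ln L" using L g by (simp add: t_def ln_div ln_mult)
  ultimately have "ln g \<le> \<theta> * growth d t" by (simp add: f_def ln_div)
  then show ?thesis by (simp add: \<theta>_def t_def)
qed

text \<open>
  At a time \<open>j\<close> when the radius \<open>M\<close> grows, \<open>z\<^sub>j\<close> has distance at least \<open>M\<^sub>j\<^sub>+\<^sub>1 / L\<close> from all earlier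
  states. Hence the balls of radius \<open>M\<^sub>j\<^sub>+\<^sub>1 / (2 L)\<close> around these \<open>z\<^sub>j\<close> are disjoint, and their total
  logarithmic volume controls \<open>ln M\<close>.
\<close>

lemma steered_to_origin_bounded:
  fixes z :: "nat \<Rightarrow> 'a::euclidean_space"
  assumes z0: "z 0 = 0" and l: "1 \<le> l" "l < kappa DIM('a)" and N: "1 \<le> N"
    and step: "\<And>n i. n \<ge> N \<Longrightarrow> i < n \<Longrightarrow> norm (z (Suc n)) \<le> l * norm (z n - z i) + c"
  shows "\<exists>B. \<forall>n. norm (z n) \<le> B"
proof (rule ccontr)
  assume "\<nexists>B. \<forall>n. norm (z n) \<le> B"
  then have unb: "\<exists>n. B < norm (z n)" for B by (meson not_le)
  let ?G = "growth DIM('a)"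
  \<comment> \<open>Strictly between \<open>l\<close> and the critical value: \<open>l < L\<close>
    absorbs the additive constant \<open>c\<close> at large radii, and
    \<open>L < kappa DIM('a)\<close> makes \<open>\<theta> < 1\<close>.\<close>
  define L where "L = (l + kappa DIM('a)) / 2"
  have L: "1 < L" "l < L" "L < kappa DIM('a)" using l by (auto simp: L_def)
  have "ln L < ln (kappa DIM('a))" using L by simp
  then have lnL: "ln L < ?G (1 / 2)" by (simp add: kappa_eq_exp_growth)
  have G: "0 < ?G (1 / 2)" by (rule growth_pos) auto
  define \<theta> where "\<theta> = ln L / ?G (1 / 2)"
  have \<theta>: "0 \<le> \<theta>" "\<theta> < 1" using L lnL G by (auto simp: \<theta>_def)
  define M where "M = running_max (\<lambda>i. norm (z i))"
  have M_ge: "norm (z i) \<le> M n" if "i \<le> n" for i n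
    using running_max_ge[OF that, of "\<lambda>i. norm (z i)"] by (simp add: M_def)
  have M_Suc: "M (Suc n) = max (norm (z (Suc n))) (M n)" for n by (simp add: M_def running_max_Suc)
  have mono: "M m \<le> M n" if "m \<le> n" for m n
    by (rule lift_Suc_mono_le[of M, OF _ that]) (simp add: M_Suc)
  \<comment> \<open>The radius from which \<open>(M n - c) / l\<close> is at least
    \<open>M n / L\<close>; the maximum with 1 keeps \<open>M n\<close> positive for the
    logarithms.\<close>
  define T where "T = max 1 (L * c / (L - l))"
  obtain m where m: "T < norm (z m)" using unb by blast
  define n0 where "n0 = max m N"
  have n0: "N \<le> n0" "T < M n0" using m M_ge[of m n0] by (auto simp: n0_def)
  have big: "1 \<le> M n" "M n \<le> L * ((M n - c) / l)" if "n \<ge> n0" for n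
  proof -
    have T: "T < M n" using n0 mono[OF that] by simp
    then show "1 \<le> M n" by (simp add: T_def)
    have "L * c / (L - l) \<le> M n" using T by (simp add: T_def)
    then have "L * c \<le> M n * (L - l)" using L by (simp add: divide_le_eq)
    then show "M n \<le> L * ((M n - c) / l)" using l by (simp add: field_simps)
  qed
  have far: "M (Suc j) \<le> L * norm (z j - z i)" if "j \<ge> n0" "M j < M (Suc j)" "i < j" for i j
  proof -
    have "M (Suc j) = norm (z (Suc j))" using that(2) by (simp add: M_Suc)
    then have "M (Suc j) \<le> l * norm (z j - z i) + c" using step[of j i] that n0 by simp
    then have "(M (Suc j) - c) / l \<le> norm (z j - z i)" using l by (simp add: divide_le_eq mult.commute)
    then have "L * ((M (Suc j) - c) / l) \<le> L * norm (z j - z i)" using L by (intro mult_left_mono) auto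
    then show ?thesis using big(2)[of "Suc j"] that by simp
  qed
  \<comment> \<open>Packing bounds the sum of the \<open>growth\<close> terms by
    \<open>ln (M K)\<close> up to constants, while each increase of \<open>ln M\<close> is at most
    \<open>\<theta>\<close> times its term; as \<open>\<theta> < 1\<close>, this bounds
    \<open>ln (M K)\<close> uniformly in \<open>K\<close>.\<close>
  have bound: "(1 - \<theta>) * (ln (M K) - ln (M n0)) \<le> \<theta> * ln (4 * L)" if K: "K \<ge> n0" for K
  proof -
    define J where "J = {j \<in> {n0..<K}. M j < M (Suc j)}"
    define s where "s j = M (Suc j) / (2 * L)" for j
    have J: "n0 \<le> j" "j < K" "M j < M (Suc j)" "1 \<le> M j" if "j \<in> J" for j
      using that big(1)[of j] by (auto simp: J_def)
    \<comment> \<open>Comparison with the initial state at the origin: each radius is at most half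
      the norm of the centre.\<close>
    have far0: "2 * s j \<le> norm (z j)" if "j \<in> J" for j
    proof -
      have "0 < j" using J(1)[OF that] n0 N by simp
      then show ?thesis using far[OF J(1)[OF that] J(3)[OF that], of 0] L
        by (simp add: z0 s_def field_simps)
    qed
    have s: "0 < s j" if "j \<in> J" for j using J[OF that] L by (simp add: s_def)
    have sep: "s i + s j < norm (z j - z i)" if "i \<in> J" "j \<in> J" "i < j" for i j
    proof -
      have "M (Suc i) \<le> M j" using that by (intro mono) simp
      then have "s i + s j < M (Suc j) / L" using J(3)[OF \<open>j \<in> J\<close>] L by (simp add: s_def field_simps)
      also have "\<dots> \<le> norm (z j - z i)"
        using far[OF J(1)[OF \<open>j \<in> J\<close>] J(3)[OF \<open>j \<in> J\<close>] \<open>i < j\<close>] L by (simp add: divide_le_eq mult.commute)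
      finally show ?thesis .
    qed
    \<comment> \<open>The ball around \<open>z j\<close> lies between radius \<open>s j\<close>,
      which is at least \<open>M n0 / (2 * L)\<close>, and radius \<open>2 * norm (z j)\<close>,
      which is at most \<open>2 * M K\<close>.\<close>
    have "(\<Sum>j\<in>J. ?G (s j / norm (z j))) \<le> ln (2 * M K / (M n0 / (2 * L)))"
    proof (rule sum_growth_le_ln)
      show "finite J" by (simp add: J_def)
      show "0 < M n0 / (2 * L)" using big(1)[of n0] L by simp
      have "M n0 / (2 * L) \<le> M n0 / 1" using L big(1)[of n0] by (intro divide_left_mono) auto
      then show "M n0 / (2 * L) \<le> 2 * M K" using mono[OF K] big(1)[of n0] by simp
      fix j assume j: "j \<in> J"
      show "0 < s j" by (rule s[OF j])
      have "M n0 \<le> M (Suc j)" using J(1)[OF j] by (intro mono) simp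
      then have "M n0 / (2 * L) \<le> s j" unfolding s_def using L by (intro divide_right_mono) auto
      then show "M n0 / (2 * L) + s j \<le> norm (z j)" using far0[OF j] by simp
      have "norm (z j) \<le> M K" using J(2)[OF j] by (intro M_ge) simp
      then show "norm (z j) + s j \<le> 2 * M K" using far0[OF j] s[OF j] by simp
      fix i assume i: "i \<in> J" "i \<noteq> j"
      then show "s i + s j < dist (z i) (z j)"
        using sep[OF i(1) j] sep[OF j i(1)] by (cases "i < j") (auto simp: dist_norm norm_minus_commute)
    qed
    also have "ln (2 * M K / (M n0 / (2 * L))) = ln (4 * L) + (ln (M K) - ln (M n0))"
      using L big(1)[of n0] big(1)[OF K] by (simp add: ln_div ln_mult)
    finally have pack: "(\<Sum>j\<in>J. ?G (s j / norm (z j))) \<le> ln (4 * L) + (ln (M K) - ln (M n0))" .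
    have "ln (M K) - ln (M n0) = (\<Sum>j=n0..<K. ln (M (Suc j)) - ln (M j))"
      by (rule sum_Suc_diff'[symmetric]) fact
    also have "\<dots> = (\<Sum>j\<in>J. ln (M (Suc j)) - ln (M j))"
    proof (rule sum.mono_neutral_right)
      show "\<forall>j\<in>{n0..<K} - J. ln (M (Suc j)) - ln (M j) = 0"
      proof
        fix j assume "j \<in> {n0..<K} - J"
        then have "M (Suc j) = M j" using mono[of j "Suc j"] by (auto simp: J_def)
        then show "ln (M (Suc j)) - ln (M j) = 0" by simp
      qed
    qed (auto simp: J_def)
    also have "\<dots> \<le> (\<Sum>j\<in>J. \<theta> * ?G (s j / norm (z j)))"
    proof (rule sum_mono)
      fix j assume j: "j \<in> J"
      have zj: "0 < norm (z j)" "norm (z j) \<le> M j" using far0[OF j] s[OF j] M_ge[of j j] by auto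
      have "2 * L * s j \<le> L * norm (z j)" using far0[OF j] L by simp
      then have MS: "M (Suc j) \<le> L * norm (z j)" using L by (simp add: s_def)
      also have "\<dots> \<le> L * M j" using zj L by simp
      finally have le: "M (Suc j) \<le> L * M j" .
      have "ln (M (Suc j)) - ln (M j) = ln (M (Suc j) / M j)" using J[OF j] by (simp add: ln_div)
      also have "\<dots> \<le> \<theta> * ?G (M (Suc j) / M j / (2 * L))"
        unfolding \<theta>_def
        by (rule ln_le_scaled_growth) (use L lnL le J[OF j] in \<open>auto simp: divide_le_eq\<close>)
      also have "\<dots> \<le> \<theta> * ?G (s j / norm (z j))"
      proof (intro mult_left_mono growth_mono)
        show "0 \<le> M (Suc j) / M j / (2 * L)" using J[OF j] L by simp
        have "s j / M j \<le> s j / norm (z j)" using s[OF j] zj J(4)[OF j] by (intro divide_left_mono mult_pos_pos) auto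
        then show "M (Suc j) / M j / (2 * L) \<le> s j / norm (z j)" by (simp add: s_def mult.commute)
        show "s j / norm (z j) < 1" using far0[OF j] s[OF j] zj by (simp add: divide_less_eq)
      qed (rule \<theta>)
      finally show "ln (M (Suc j)) - ln (M j) \<le> \<theta> * ?G (s j / norm (z j))" .
    qed
    also have "\<dots> \<le> \<theta> * (ln (4 * L) + (ln (M K) - ln (M n0)))"
      unfolding sum_distrib_left[symmetric] using pack \<theta> by (intro mult_left_mono) auto
    finally show ?thesis by (simp add: algebra_simps)
  qed
  define b where "b = \<theta> * ln (4 * L) / (1 - \<theta>) + ln (M n0)"
  have ln_le: "ln (M K) \<le> b" if "K \<ge> n0" for K
    using bound[OF that] \<theta> by (simp add: b_def pos_le_divide_eq mult.commute flip: diff_le_eq)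
  obtain n where n: "exp b < norm (z n)" using unb by blast
  define K where "K = max n n0"
  have "exp b < M K" using n M_ge[of n K] by (simp add: K_def)
  then have "b < ln (M K)" by (metis exp_gt_zero ln_exp ln_less_cancel_iff less_trans)
  then show False using ln_le[of K] by (simp add: K_def)
qed

text \<open>The controller aims at the initial state, the \<open>hd\<close> of the list of states;
  subtracting \<open>x 0\<close> moves it to the origin.\<close>

lemma winning_histories_empty_below_kappa:
  assumes l: "1 \<le> l" "l < kappa DIM('a)"
  shows "(winning_histories l :: 'a::euclidean_space history set) = {}"
proof (rule ccontr)
  assume ne: "(winning_histories l :: 'a history set) \<noteq> {}"
  have l0: "0 \<le> l" using l by simp
  show False
  proof (rule nearest_neighbour_controller[OF l0 ne, of hd])
    fix x :: "nat \<Rightarrow> 'a" and c N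
    assume "1 \<le> N"
      and x: "\<And>n j. N \<le> n \<Longrightarrow> j < n \<Longrightarrow>
        norm (x (Suc n) - hd (map x [0..<Suc n])) \<le> l * norm (x n - x j) + c"
      and unb: "\<And>B. \<exists>n. B < norm (x n - x 0)"
    have hd: "hd (map x [0..<Suc n]) = x 0" for n
      by (simp add: upt_conv_Cons del: upt_Suc)
    have "\<exists>B. \<forall>n. norm (x n - x 0) \<le> B"
    proof (rule steered_to_origin_bounded[OF _ l \<open>1 \<le> N\<close>])
      show "norm (x (Suc n) - x 0) \<le> l * norm (x n - x 0 - (x i - x 0)) + c" if "N \<le> n" "i < n" for n i
        using x[OF that] unfolding hd by simp
    qed simp
    then show False using unb by (meson not_le)
  qed
qed

section \<open>From thresholds for \<open>l\<close> to bounds on the game value\<close>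

lemma ennreal_le_of_dense:
  assumes "0 \<le> a" "a < b" "\<And>r. a < r \<Longrightarrow> r < b \<Longrightarrow> ennreal r \<le> v"
  shows "ennreal b \<le> v"
proof (rule dense_le_bounded[of "ennreal a"])
  show "ennreal a < ennreal b" using assms by (simp add: ennreal_less_iff)
  fix w assume w: "ennreal a < w" "w < ennreal b"
  then obtain r where "0 \<le> r" "w = ennreal r" by (cases w) auto
  then show "w \<le> v" using w assms by (auto simp: ennreal_less_iff)
qed

lemma game_value_ge:
  assumes "0 \<le> l" "(winning_histories l :: 'a::euclidean_space history set) = {}"
  shows "ennreal l \<le> game_value TYPE('a)"
  unfolding game_value_def by (rule Sup_upper) (use assms in auto)

lemma game_value_le: "game_value TYPE('a::euclidean_space) \<le> ennreal (3 / 2 + sqrt 2)"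
  unfolding game_value_def
proof (rule Sup_least)
  fix v assume "v \<in> {0} \<union> {ennreal l |l. 0 \<le> l \<and> (winning_histories l :: 'a history set) = {}}"
  then consider "v = 0" | l where "v = ennreal l" "(winning_histories l :: 'a history set) = {}" by blast
  then show "v \<le> ennreal (3 / 2 + sqrt 2)"
  proof cases
    case 2
    have "l \<le> 3 / 2 + sqrt 2"
    proof (rule ccontr)
      assume "\<not> l \<le> 3 / 2 + sqrt 2"
      \<comment> \<open>\<open>1 + sqrt 2 / 2\<close> is the larger root of
        \<open>s\<^sup>2 - 2 * s + 1 / 2\<close>; with \<open>s = sqrt l\<close> at or above it, the
        condition \<open>2 * sqrt l \<le> l + 1 / 2\<close> of the expanding adversary
        holds.\<close>
      moreover have "(1 + sqrt 2 / 2)\<^sup>2 = 3 / 2 + sqrt 2" by (simp add: power2_eq_square algebra_simps)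
      moreover have "0 \<le> sqrt 2" by simp
      ultimately have l: "1 < l" "(1 + sqrt 2 / 2)\<^sup>2 \<le> l" by linarith+
      then have "1 + sqrt 2 / 2 \<le> sqrt l" by (intro real_le_rsqrt)
      then have "(sqrt 2 / 2)\<^sup>2 \<le> (sqrt l - 1)\<^sup>2" by (intro power_mono) auto
      also have "\<dots> = l - 2 * sqrt l + 1" using l by (simp add: power2_eq_square algebra_simps)
      finally have "2 * sqrt l \<le> l + 1 / 2" by (simp add: power2_eq_square)
      then show False using winning_histories_nonempty[of l, where 'a = 'a] l 2 by simp
    qed
    then show ?thesis unfolding 2(1) by (rule ennreal_leI)
  qed simp
qed

lemma kappa_le_game_value: "ennreal (kappa DIM('a)) \<le> game_value TYPE('a::euclidean_space)"
proof (rule ennreal_le_of_dense[of 1])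
  have "0 < growth DIM('a) (1 / 2)" by (rule growth_pos) auto
  then show "1 < kappa DIM('a)" by (simp add: kappa_eq_exp_growth)
  show "ennreal r \<le> game_value TYPE('a)" if "1 < r" "r < kappa DIM('a)" for r
    by (rule game_value_ge) (use that winning_histories_empty_below_kappa[where 'a = 'a] in auto)
qed simp

lemma game_value_dim_one: "game_value TYPE(real ^ 1) = ennreal (3 / 2 + sqrt 2)"
proof (rule antisym[OF game_value_le ennreal_le_of_dense[of 1]])
  show "1 < 3 / 2 + sqrt 2" using real_sqrt_ge_zero[of 2] by linarith
  fix l :: real
  assume l: "1 < l" "l < 3 / 2 + sqrt 2"
  \<comment> \<open>The required condition is \<open>(l - 3 / 2)\<^sup>2 < 2\<close>; for
    \<open>l > 1\<close> its lower side follows from \<open>1 < sqrt 2\<close>.\<close>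
  have "1 < sqrt 2" by simp
  then have "\<bar>l - 3 / 2\<bar> < sqrt 2" using l by linarith
  then have "(l - 3 / 2)\<^sup>2 < (sqrt 2)\<^sup>2" by (metis abs_ge_zero power2_abs power_strict_mono zero_less_numeral)
  then have "l\<^sup>2 - 3 * l + 1 / 4 < 0" by (simp add: power2_eq_square algebra_simps)
  then show "ennreal l \<le> game_value TYPE(real ^ 1)"
    using l by (intro game_value_ge winning_histories_dim_one_empty) auto
qed simp

lemma kappa_two: "kappa 2 = 2 / sqrt 3"
proof -
  have "((\<lambda>t. t / (1 - t\<^sup>2)) has_integral - ln (1 - (1 / 2)\<^sup>2) / 2 - - ln (1 - 0\<^sup>2) / 2) {0..1 / 2::real}"
  proof (rule fundamental_theorem_of_calculus)
    fix t :: real assume t: "t \<in> {0..1 / 2}"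
    then have "t\<^sup>2 < 1" using power_strict_mono[of t 1 2] by simp
    then show "((\<lambda>t. - ln (1 - t\<^sup>2) / 2) has_vector_derivative t / (1 - t\<^sup>2)) (at t within {0..1 / 2})"
      unfolding has_real_derivative_iff_has_vector_derivative[symmetric]
      by (auto intro!: derivative_eq_intros simp: field_simps)
  qed simp
  then have "integral {0..1 / 2::real} (\<lambda>t. t / (1 - t\<^sup>2)) = - ln (3 / 4) / 2"
    by (intro integral_unique) (simp add: power2_eq_square)
  also have "\<dots> = ln (2 / sqrt 3)"
  proof -
    have "ln 4 = 2 * ln (2::real)" using ln_realpow[of 2 2] by simp
    then show ?thesis by (simp add: ln_div ln_sqrt)
  qed
  finally show ?thesis by (simp add: kappa_def)
qed

theorem corollary3p11:
  shows "ennreal (kappa CARD('n::finite)) \<le> game_value TYPE(real ^ 'n)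
    \<and> game_value TYPE(real ^ 'n) \<le> game_value TYPE(real ^ 1)
    \<and> game_value TYPE(real ^ 1) = ennreal (3 / 2 + sqrt 2)
    \<and> ennreal (2 / sqrt 3) \<le> game_value TYPE(real ^ 2)
    \<and> game_value TYPE(real ^ 2) \<le> ennreal (3 / 2 + sqrt 2)"
  using kappa_le_game_value[where 'a = "real ^ 'n"] kappa_le_game_value[where 'a = "real ^ 2"]
    game_value_le[where 'a = "real ^ 'n"] game_value_le[where 'a = "real ^ 2"]
  by (simp add: game_value_dim_one kappa_two)

end
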